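(* Let $p>5$ be a prime and put $\Phi=(p-2)(p-3)(p-4)$ and $\beta=15(p-3)$. Then the number of conjugacy classes (under conjugation in $\mathrm{PGL}_{5}(\mathbb{C})$) of admissible cyclic subgroups of order $p$ of $\mathrm{PGL}_{5}(\mathbb{C})$ is \begin{itemize} \item $\dfrac{\beta}{60}+\dfrac{\Phi-\beta}{120}$ if $p\not\equiv 1 \pmod 5$ and $p\not\equiv 1\pmod 4$; \item $1+\dfrac{\beta-30}{60}+\dfrac{\Phi-\beta}{120}$ if $p\not\equiv 1 \pmod 5$ and $p\equiv 1\pmod 4$; \item $1+\dfrac{\beta}{60}+\dfrac{\Phi-\beta-24}{120}$ if $p\equiv 1 \pmod 5$ and $p\not\equiv 1\pmod 4$; \item $2+\dfrac{\beta-30}{60}+\dfrac{\Phi-\beta-24}{120}$ if $p\equiv 1 \pmod 5$ and $p\equiv 1\pmod 4$. \end{itemize}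
   Context: A set of points in $\mathbb{P}^k(\mathbb{C})$ is in general position if any subset of $t\le k+1$ of its points spans a $(t-1)$-dimensional linear projective subspace. The group $\mathrm{PGL}_{k+1}(\mathbb{C})$ acts on $\mathbb{P}^k(\mathbb{C})$ and hence on finite sets of points; for a finite set $T$ of points, $\mathrm{Aut}(T)=\{f\in \mathrm{PGL}_{k+1}(\mathbb{C}) : T^f=T\}$ (setwise stabilizer). A finite subgroup $H$ of $\mathrm{PGL}_{k+1}(\mathbb{C})$ is called admissible if there exists a finite set $T$ of $n\ge k+3$ distinct points of $\mathbb{P}^k(\mathbb{C})$ in general position such that $H\subseteq \mathrm{Aut}(T)$. Here $k=4$. *)

theory Defs
  imports
    "HOL-Analysis.Determinants"
    "HOL-Algebra.Group_Action"
    "HOL-Algebra.Elementary_Groups"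
    "HOL-Computational_Algebra.Primes"
    "HOL-Number_Theory.Cong"
begin

text \<open>
  Throughout, the index type \<open>'n\<close> has \<open>k + 1\<close> elements: \<open>complex^'n\<close> is the vector space
  underlying \<open>k\<close>-dimensional projective space.  Linear algebra over \<open>complex\<close> is
  that of the locale interpretation \<open>vec\<close>; the unqualified \<open>span\<close>, \<open>dim\<close> and \<open>subspace\<close>
  are the real notions.
\<close>

definition GL :: "(complex^'n^'n) monoid" where
  "GL = \<lparr>carrier = {A. invertible A}, monoid.mult = (**), one = mat 1\<rparr>"

definition scalars :: "(complex^'n^'n) set" where
  "scalars = {mat c | c. c \<noteq> 0}"

definition PGL :: "(complex^'n^'n) set monoid" where
  "PGL = GL Mod scalars"

definition proj_points :: "(complex^'n) set set" where
  "proj_points = {L. vec.subspace L \<and> vec.dim L = 1}"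

text \<open>
  An element of \<open>PGL\<close> is a coset of matrices that differ by nonzero scalar factors, so they
  all map a line to the same line (see \<open>proj_act_rcoset\<close> below); the union just avoids
  choosing one of them.
\<close>

definition proj_act :: "(complex^'n^'n) set \<Rightarrow> (complex^'n) set \<Rightarrow> (complex^'n) set" where
  "proj_act F L = (\<Union>A\<in>F. (\<lambda>v. A *v v) ` L)"

text \<open>
  The projective subspace spanned by the points in \<open>S\<close> is the projectivization of the linear
  span of \<open>\<Union>S\<close>, and its projective dimension is one less than the linear dimension.
\<close>

definition general_position :: "(complex^'n) set set \<Rightarrow> bool" where
  "general_position T \<longleftrightarrow>
     (\<forall>S \<subseteq> T. finite S \<and> card S \<le> CARD('n) \<longrightarrow> vec.dim (vec.span (\<Union>S)) = card S)"

definition Aut :: "(complex^'n) set set \<Rightarrow> (complex^'n^'n) set set" where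
  "Aut T = {F \<in> carrier PGL. proj_act F ` T = T}"

text \<open>The bound \<open>CARD('n) + 2\<close> is \<open>k + 3\<close>.\<close>

definition admissible :: "(complex^'n^'n) set set \<Rightarrow> bool" where
  "admissible H \<longleftrightarrow> subgroup H PGL \<and> finite H \<and>
     (\<exists>T \<subseteq> proj_points. finite T \<and> card T \<ge> CARD('n) + 2 \<and> general_position T \<and> H \<subseteq> Aut T)"

definition admissible_cyclic_subgroups :: "nat \<Rightarrow> (complex^'n^'n) set set set" where
  "admissible_cyclic_subgroups m =
     {H. admissible H \<and> cyclic_group (subgroup_generated PGL H) \<and> card H = m}"

definition conjugacy_classes :: "(complex^'n^'n) set set set \<Rightarrow> (complex^'n^'n) set set set set" where
  "conjugacy_classes X = orbits PGL X (\<lambda>g H. g <#\<^bsub>PGL\<^esub> H #>\<^bsub>PGL\<^esub> inv\<^bsub>PGL\<^esub> g)"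

lemma GL_simps [simp]:
  "carrier GL = {A. invertible A}" "A \<otimes>\<^bsub>GL\<^esub> B = A ** B" "\<one>\<^bsub>GL\<^esub> = mat 1"
  by (simp_all add: GL_def)

lemma group_GL: "group (GL :: (complex^'n^'n) monoid)"
proof (rule groupI)
  fix A :: "complex^'n^'n" assume "A \<in> carrier GL"
  then obtain B where "A ** B = mat 1" "B ** A = mat 1" by (auto simp: invertible_def)
  then show "\<exists>B\<in>carrier GL. B \<otimes>\<^bsub>GL\<^esub> A = \<one>\<^bsub>GL\<^esub>"
    by (auto simp: invertible_def)
next
  show "\<one>\<^bsub>GL\<^esub> \<in> carrier (GL :: (complex^'n^'n) monoid)"
    using matrix_mul_lid[of "mat 1 :: complex^'n^'n"] by (auto simp: invertible_def)
qed (simp_all add: invertible_mult matrix_mul_assoc)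

lemma mat_mult_left: "mat c ** A = (\<chi> i j. c * A $ i $ j)" for A :: "complex^'n^'n"
proof -
  have "(\<Sum>k\<in>UNIV. (if i = k then c else 0) * A $ k $ j) = (\<Sum>k\<in>UNIV. if k = i then c * A $ k $ j else 0)"
    for i j by (rule sum.cong) auto
  then show ?thesis by (simp add: matrix_matrix_mult_def mat_def vec_eq_iff)
qed

lemma mat_mult_right: "A ** mat c = (\<chi> i j. c * A $ i $ j)" for A :: "complex^'n^'n"
proof -
  have "(\<Sum>k\<in>UNIV. A $ i $ k * (if k = j then c else 0)) = (\<Sum>k\<in>UNIV. if k = j then c * A $ i $ k else 0)"
    for i j by (rule sum.cong) auto
  then show ?thesis by (simp add: matrix_matrix_mult_def mat_def vec_eq_iff)
qed

lemma mat_mult_mat: "mat a ** mat b = (mat (a * b) :: complex^'n^'n)"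
  unfolding mat_mult_left by (simp add: vec_eq_iff mat_def)

lemma mat_mult_commute: "mat c ** A = A ** mat c" for A :: "complex^'n^'n"
  by (simp only: mat_mult_left mat_mult_right)

lemma mat_mult_vec: "mat c *v v = c *s (v :: complex^'n)"
proof -
  have "(\<Sum>k\<in>UNIV. (if i = k then c else 0) * v $ k) = (\<Sum>k\<in>UNIV. if k = i then c * v $ k else 0)"
    for i by (rule sum.cong) auto
  then show ?thesis by (simp add: matrix_vector_mult_def mat_def vec_eq_iff)
qed

lemma mat_1_in_scalars: "mat 1 \<in> scalars"
  unfolding scalars_def by (intro CollectI exI[of _ 1]) simp

lemma normal_scalars: "scalars \<lhd> (GL :: (complex^'n^'n) monoid)"
proof -
  interpret group "GL :: (complex^'n^'n) monoid" by (rule group_GL)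
  have inv: "inv\<^bsub>GL\<^esub> mat c = (mat (1 / c) :: complex^'n^'n)" and invertible_c: "invertible (mat c :: complex^'n^'n)"
    if "c \<noteq> 0" for c
  proof -
    have 1: "mat c ** mat (1 / c) = (mat 1 :: complex^'n^'n)" "mat (1 / c) ** mat c = (mat 1 :: complex^'n^'n)"
      using that by (simp_all add: mat_mult_mat)
    then show "invertible (mat c :: complex^'n^'n)" by (auto simp: invertible_def)
    show "inv\<^bsub>GL\<^esub> mat c = (mat (1 / c) :: complex^'n^'n)"
      using 1 by (intro inv_equality) (auto simp: invertible_def)
  qed
  have "subgroup scalars (GL :: (complex^'n^'n) monoid)"
  proof (rule subgroupI)
    show "scalars \<subseteq> carrier (GL :: (complex^'n^'n) monoid)"
      using invertible_c by (auto simp: scalars_def)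
    show "(scalars :: (complex^'n^'n) set) \<noteq> {}"
      using mat_1_in_scalars by (metis empty_iff)
    fix a b :: "complex^'n^'n" assume "a \<in> scalars"
    then obtain c where c: "a = mat c" "c \<noteq> 0" by (auto simp: scalars_def)
    then have "inv\<^bsub>GL\<^esub> a = mat (1 / c)" using inv by simp
    then show "inv\<^bsub>GL\<^esub> a \<in> scalars" using c unfolding scalars_def
      by (intro CollectI exI[of _ "1 / c"]) simp
    assume "b \<in> scalars"
    then obtain d where d: "b = mat d" "d \<noteq> 0" by (auto simp: scalars_def)
    show "a \<otimes>\<^bsub>GL\<^esub> b \<in> scalars" using c d unfolding scalars_def
      by (intro CollectI exI[of _ "c * d"]) (simp add: mat_mult_mat)
  qed
  then show ?thesis
  proof (rule normalI)
    show "\<forall>x\<in>carrier (GL :: (complex^'n^'n) monoid). scalars #>\<^bsub>GL\<^esub> x = x <#\<^bsub>GL\<^esub> scalars"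
      by (auto simp: r_coset_def l_coset_def scalars_def mat_mult_commute)
  qed
qed

lemma group_PGL: "group (PGL :: (complex^'n^'n) set monoid)"
  unfolding PGL_def using normal_scalars by (rule normal.factorgroup_is_group)

lemma proj_act_rcoset:
  fixes L :: "(complex^'n) set"
  assumes "vec.subspace L"
  shows "proj_act (scalars #>\<^bsub>GL\<^esub> A) L = (\<lambda>v. A *v v) ` L"
proof
  have "mat c ** A *v v = A *v (c *s v)" for c v
    by (metis mat_mult_commute mat_mult_vec matrix_vector_mul_assoc)
  then show "proj_act (scalars #>\<^bsub>GL\<^esub> A) L \<subseteq> (\<lambda>v. A *v v) ` L"
    using assms by (auto simp: proj_act_def r_coset_def scalars_def vec.subspace_scale)
  have "mat 1 \<otimes>\<^bsub>GL\<^esub> A \<in> scalars #>\<^bsub>GL\<^esub> A"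
    unfolding r_coset_def using mat_1_in_scalars by (intro UN_I[of "mat 1"]) simp_all
  then have "A \<in> scalars #>\<^bsub>GL\<^esub> A"
    by simp
  then show "(\<lambda>v. A *v v) ` L \<subseteq> proj_act (scalars #>\<^bsub>GL\<^esub> A) L"
    by (auto simp: proj_act_def)
qed

end

theory Submission
  imports Defs "HOL-Computational_Algebra.Polynomial" "HOL-Number_Theory.Residue_Primitive_Roots"
begin

text \<open>
  Let \<open>x\<close> generate an admissible cyclic group of prime order \<open>p > 5\<close> that preserves a set \<open>T\<close> of at
  least seven points in general position, and lift \<open>x\<close> to a matrix \<open>A\<close> with \<open>A\<^sup>p = 1\<close>.  If \<open>A\<close>
  fixed all points of \<open>T\<close>, then six of them would be eigenlines in general position and \<open>A\<close> would be
  scalar (\<open>fixed_points_scalar\<close>).  So some point of \<open>T\<close> is moved; its orbit consists of \<open>p\<close> points,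
  any five of which span, so the moved point is spanned by a cyclic vector
  (\<open>moved_point_cyclic_vector\<close>), and Fourier sums over the powers of \<open>A\<close> turn this vector into an
  eigenbasis with five different \<open>p\<close>-th roots of unity as eigenvalues
  (\<open>cyclic_vector_diagonalization\<close>).  Conversely, a diagonal matrix with five different \<open>p\<close>-th roots
  of unity on the diagonal permutes the \<open>p\<close> points of the orbit of \<open>(1, \<dots>, 1)\<close>.  That these are in
  general position says that the minors of the Fourier matrix of prime order do not vanish, which
  is Chebotarev's theorem (\<open>chebotarev\<close>).

  An admissible cyclic group of order \<open>p\<close> is therefore given, up to conjugacy, by a set \<open>E\<close> of five
  \<open>p\<close>-th roots of unity.  Rescaling \<open>A\<close> multiplies \<open>E\<close> by a root of unity; as \<open>5\<close> is invertible
  modulo \<open>p\<close>, exactly one multiple of \<open>E\<close> has product 1.  Another choice of the generator replaces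
  \<open>E\<close> by the set of its \<open>k\<close>-th powers.  So the conjugacy classes correspond to the orbits of the
  units \<open>k\<close> modulo \<open>p\<close> on the five-element sets of \<open>p\<close>-th roots of unity with product 1
  (\<open>card_conjugacy_classes\<close>).

  Burnside's lemma counts these orbits (\<open>card_power_orbits\<close>).  There are \<open>(p choose 5) / p\<close> sets.  The
  powers of a unit of order \<open>d > 1\<close> permute the \<open>p - 1\<close> nontrivial roots of unity in orbits of size
  \<open>d\<close>, and an invariant set is a union of such orbits, with or without the root 1.  With five
  elements this leaves \<open>d = 2\<close> (two orbits and 1), \<open>d = 4\<close> (one orbit and 1) and \<open>d = 5\<close> (one orbit),
  and there are 1, 2 and 4 units of these orders when \<open>d\<close> divides \<open>p - 1\<close>.  The number of orbits is
  thus \<open>(p - 2) (p - 3) (p - 4) / 120 + (p - 3) / 8\<close>, plus \<open>1 / 2\<close> if \<open>4\<close> divides \<open>p - 1\<close>, plus \<open>4 / 5\<close>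
  if \<open>5\<close> divides \<open>p - 1\<close>.
\<close>


section \<open>Roots of unity of prime order\<close>

abbreviation unity_roots :: "nat \<Rightarrow> complex set" where
  "unity_roots p \<equiv> {z. z ^ p = 1}"

lemma root_power_eq_1_iff:
  fixes z :: complex
  assumes "prime p" "z ^ p = 1" "z \<noteq> 1"
  shows "z ^ k = 1 \<longleftrightarrow> p dvd k"
proof
  assume zk: "z ^ k = 1"
  show "p dvd k"
  proof (rule ccontr)
    assume "\<not> p dvd k"
    then have "coprime k p"
      using assms(1) prime_imp_coprime coprime_commute by blast
    moreover have "k \<noteq> 0" using \<open>\<not> p dvd k\<close> by (intro notI) simp
    ultimately obtain x y where "k * x = p * y + 1"
      using bezout_nat[of k p] by (auto simp: coprime_iff_gcd_eq_1)
    then have "z ^ (k * x) = z ^ (p * y + 1)" by simp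
    then show False
      using zk assms by (simp add: power_mult power_add)
  qed
next
  assume "p dvd k" then show "z ^ k = 1"
    using assms by (auto simp: power_mult elim!: dvdE)
qed

lemma root_power_eq_iff:
  fixes z :: complex
  assumes "prime p" "z ^ p = 1" "z \<noteq> 1"
  shows "z ^ k = z ^ l \<longleftrightarrow> [k = l] (mod p)"
proof -
  have z0: "z \<noteq> 0" using assms by (metis power_0_left prime_gt_0_nat less_numeral_extra(3) zero_neq_one)
  have *: "z ^ k = z ^ l \<longleftrightarrow> [k = l] (mod p)" if "k \<le> l" for k l
  proof -
    have "z ^ l = z ^ k * z ^ (l - k)" using that by (simp add: power_add [symmetric])
    then have "z ^ k = z ^ l \<longleftrightarrow> z ^ (l - k) = 1" using z0 by auto
    also have "\<dots> \<longleftrightarrow> p dvd l - k" by (rule root_power_eq_1_iff) fact+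
    also have "\<dots> \<longleftrightarrow> [k = l] (mod p)"
      using that by (metis cong_altdef_nat cong_sym)
    finally show ?thesis .
  qed
  show ?thesis
    using *[of k l] *[of l k] by (metis cong_sym nat_le_linear)
qed

lemma unity_roots_eq_powers:
  assumes "prime p" "z ^ p = 1" "z \<noteq> 1"
  shows "bij_betw (\<lambda>k. z ^ k) {..<p} (unity_roots p)"
proof -
  have p: "p > 0" using assms(1) by (simp add: prime_gt_0_nat)
  have inj: "inj_on (\<lambda>k. z ^ k) {..<p}"
    by (rule inj_onI) (use assms in \<open>auto simp: root_power_eq_iff cong_less_modulus_unique_nat\<close>)
  have "(\<lambda>k. z ^ k) ` {..<p} = unity_roots p"
  proof (rule card_subset_eq)
    show "finite (unity_roots p)" using p finite_roots_unity[of p] by simp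
    show "(\<lambda>k. z ^ k) ` {..<p} \<subseteq> unity_roots p"
      using assms by (auto simp: power_mult [symmetric] mult.commute[of _ p]) (simp add: power_mult)
    show "card ((\<lambda>k. z ^ k) ` {..<p}) = card (unity_roots p)"
      using p by (simp add: card_image[OF inj] card_roots_unity_eq)
  qed
  with inj show ?thesis by (simp add: bij_betw_def)
qed

lemma primitive_unity_root_exists:
  assumes "prime p"
  obtains z :: complex where "z ^ p = 1" "z \<noteq> 1"
proof -
  have "\<not> unity_roots p \<subseteq> {1}"
    using card_roots_unity_eq[of p] card_mono[of "{1}" "unity_roots p"] prime_gt_1_nat[OF assms] by auto
  then show ?thesis using that by auto
qed

lemma sum_powers_root:
  fixes z :: complex
  assumes "z ^ p = 1"
  shows "(\<Sum>k<p. z ^ k) = (if z = 1 then of_nat p else 0)"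
  using assms by (simp add: sum_gp_strict)

lemma inj_on_power_unity_roots:
  assumes "prime p" "\<not> p dvd k"
  shows "inj_on (\<lambda>z. z ^ k) (unity_roots p)"
proof (rule inj_onI)
  fix z w :: complex assume "z \<in> unity_roots p" "w \<in> unity_roots p" and eq: "z ^ k = w ^ k"
  then have zw: "z ^ p = 1" "w ^ p = 1" by auto
  have "p > 0" using assms(1) by (simp add: prime_gt_0_nat)
  then have w0: "w \<noteq> 0" using zw by (metis power_0_left less_numeral_extra(3) zero_neq_one)
  have "(z / w) ^ p = 1" "(z / w) ^ k = 1"
    using zw eq w0 by (simp_all add: power_divide)
  then have "z / w = 1"
    using root_power_eq_1_iff[OF assms(1), of "z / w" k] assms(2) by auto
  then show "z = w" using w0 by simp
qed

lemma power_image_unity_roots: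
  assumes "prime p" "\<not> p dvd k"
  shows "(\<lambda>z. z ^ k) ` unity_roots p = unity_roots p"
proof (rule endo_inj_surj)
  show "finite (unity_roots p)" 
    using finite_roots_unity[of p] prime_gt_0_nat[OF assms(1)] by simp
  show "(\<lambda>z. z ^ k) ` unity_roots p \<subseteq> unity_roots p"
    by (auto simp: power_mult [symmetric] mult.commute[of k]) (simp add: power_mult)
qed (use assms inj_on_power_unity_roots in auto)

lemma sum_powers_over_unity_roots:
  assumes "prime p"
  shows "(\<Sum>z\<in>unity_roots p. z ^ i) = (if p dvd i then of_nat p else 0)"
proof -
  obtain \<zeta> :: complex where \<zeta>: "\<zeta> ^ p = 1" "\<zeta> \<noteq> 1"
    using primitive_unity_root_exists[OF assms] .
  have "(\<Sum>z\<in>unity_roots p. z ^ i) = (\<Sum>k<p. (\<zeta> ^ k) ^ i)"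
    using sum.reindex_bij_betw[OF unity_roots_eq_powers[OF assms \<zeta>], of "\<lambda>z. z ^ i"] by simp
  also have "\<dots> = (\<Sum>k<p. (\<zeta> ^ i) ^ k)"
    by (simp add: power_mult [symmetric] mult.commute)
  also have "\<dots> = (if \<zeta> ^ i = 1 then of_nat p else 0)"
    by (rule sum_powers_root) (metis \<zeta>(1) mult.commute power_mult power_one)
  finally show ?thesis by (simp add: root_power_eq_1_iff[OF assms \<zeta>])
qed

section \<open>Chebotarev's theorem on minors of the Fourier matrix\<close>

text \<open>
  Polynomials with integer coefficients are kept inside \<open>complex poly\<close>, so that they can be evaluated
  at roots of unity without a coercion.
\<close>

definition integral_poly :: "complex poly \<Rightarrow> bool" where
  "integral_poly P \<longleftrightarrow> (\<forall>i. poly.coeff P i \<in> \<int>)"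

lemma integral_poly_simps [simp]:
  "integral_poly 0" "integral_poly 1" "integral_poly (Polynomial.monom 1 n)" "integral_poly (of_int m)"
  by (auto simp: integral_poly_def of_int_poly coeff_pCons split: nat.splits)

lemma integral_poly_add: "integral_poly P \<Longrightarrow> integral_poly Q \<Longrightarrow> integral_poly (P + Q)"
  by (simp add: integral_poly_def)

lemma integral_poly_mult: "integral_poly P \<Longrightarrow> integral_poly Q \<Longrightarrow> integral_poly (P * Q)"
  by (simp add: integral_poly_def coeff_mult Ints_sum)

lemma integral_poly_sum: "(\<And>i. i \<in> A \<Longrightarrow> integral_poly (f i)) \<Longrightarrow> integral_poly (sum f A)"
  by (simp add: integral_poly_def coeff_sum Ints_sum)

lemma integral_poly_prod: "(\<And>i. i \<in> A \<Longrightarrow> integral_poly (f i)) \<Longrightarrow> integral_poly (prod f A)"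
  by (induction A rule: infinite_finite_induct) (auto intro: integral_poly_mult)

lemma integral_poly_pcompose:
  assumes "integral_poly P" "integral_poly Q"
  shows "integral_poly (pcompose P Q)"
  using assms(1)
proof (induction P)
  case (pCons a P)
  have "poly.coeff (pCons a P) 0 \<in> \<int>" using pCons.prems unfolding integral_poly_def by blast
  moreover have "poly.coeff P i \<in> \<int>" for i
    using pCons.prems unfolding integral_poly_def by (metis coeff_pCons_Suc)
  ultimately have "integral_poly [:a:]" "integral_poly P"
    by (auto simp: integral_poly_def coeff_pCons split: nat.splits)
  then show ?case
    using pCons.IH assms(2) by (simp add: pcompose_pCons integral_poly_add integral_poly_mult)
qed auto

text \<open>
  Of \<open>R = \<Sum>i. c i * x ^ i\<close> only the terms with \<open>p dvd i\<close> survive the summation, each with weight \<open>p\<close>.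
\<close>

lemma sum_over_unity_roots:
  assumes "prime p" "integral_poly R"
  obtains m :: int where "(\<Sum>z\<in>unity_roots p. poly R z) = of_nat p * of_int m"
proof -
  note * = sum_powers_over_unity_roots[OF assms(1)]
  have "(\<Sum>z\<in>unity_roots p. poly R z) = (\<Sum>i\<le>degree R. poly.coeff R i * (\<Sum>z\<in>unity_roots p. z ^ i))"
    unfolding poly_altdef by (subst sum.swap) (simp add: sum_distrib_left)
  also have "\<dots> = of_nat p * (\<Sum>i\<le>degree R. if p dvd i then poly.coeff R i else 0)"
    unfolding * sum_distrib_left by (rule sum.cong) auto
  also have "(\<Sum>i\<le>degree R. if p dvd i then poly.coeff R i else 0) \<in> \<int>"
    using assms(2) by (auto simp: integral_poly_def intro!: Ints_sum)
  then have "\<exists>m. of_nat p * (\<Sum>i\<le>degree R. if p dvd i then poly.coeff R i else 0) = of_nat p * of_int m"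
    by (metis Ints_cases)
  ultimately show ?thesis using that by auto
qed

lemma integral_poly_eval_1:
  assumes "integral_poly Q"
  obtains q :: int where "poly Q 1 = of_int q"
proof -
  have "poly Q 1 \<in> \<int>"
    using assms by (auto simp: poly_altdef integral_poly_def intro!: Ints_sum)
  then show ?thesis using that by (auto elim: Ints_cases)
qed

text \<open>
  Modulo the prime \<open>1 - \<zeta>\<close> of \<open>\<int>[\<zeta>]\<close> the numbers \<open>Q(\<zeta>)\<close> and \<open>Q(1)\<close> agree.  For an elementary argument take
  the product \<open>R\<close> of the polynomials \<open>Q(x ^ j)\<close> for \<open>0 < j < p\<close>.  It vanishes at every \<open>p\<close>-th root of unity
  except 1, because \<open>\<zeta>\<close> is a power of each of them, so the sum of \<open>R\<close> over all roots is
  \<open>R(1) = Q(1) ^ (p - 1)\<close>.  The same sum is a multiple of \<open>p\<close>.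
\<close>

lemma prime_dvd_eval_1:
  assumes "prime p" "integral_poly Q" "\<zeta> ^ p = 1" "\<zeta> \<noteq> 1" "poly Q \<zeta> = 0" "poly Q 1 = of_int q"
  shows "int p dvd q"
proof -
  define R where "R = (\<Prod>j\<in>{1..<p}. pcompose Q (Polynomial.monom 1 j))"
  have R: "poly R z = (\<Prod>j\<in>{1..<p}. poly Q (z ^ j))" for z
    by (simp add: R_def poly_prod poly_pcompose poly_monom)
  have "integral_poly R"
    unfolding R_def by (intro integral_poly_prod integral_poly_pcompose assms) simp
  then obtain m :: int where m: "(\<Sum>z\<in>unity_roots p. poly R z) = of_nat p * of_int m"
    using sum_over_unity_roots[OF assms(1)] by blast
  have "poly R z = 0" if "z \<in> unity_roots p - {1}" for z
  proof -
    have z: "z ^ p = 1" "z \<noteq> 1" using that by auto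
    have "\<zeta> \<in> (\<lambda>k. z ^ k) ` {..<p}"
      using unity_roots_eq_powers[OF assms(1) z] assms(3) by (simp add: bij_betw_def)
    then obtain k where k: "k < p" "\<zeta> = z ^ k" by auto
    moreover have "k \<noteq> 0" using k assms(4) by (intro notI) simp
    ultimately have "k \<in> {1..<p}" "poly Q (z ^ k) = 0" using assms(5) by auto
    then show ?thesis unfolding R by (intro prod_zero) auto
  qed
  then have "(\<Sum>z\<in>unity_roots p. poly R z) = (\<Sum>z\<in>{1}. poly R z)"
    using prime_gt_0_nat[OF assms(1)] finite_roots_unity[of p]
    by (intro sum.mono_neutral_right) auto
  also have "\<dots> = of_int (q ^ (p - 1))" by (simp add: R assms(6))
  finally have "(of_int (q ^ (p - 1)) :: complex) = of_int (int p * m)"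
    using m by simp
  then have "q ^ (p - 1) = int p * m" using of_int_eq_iff by blast
  then have "int p dvd q ^ (p - 1)" by simp
  then show ?thesis using assms(1) prime_dvd_power[of "int p"] by auto
qed

text \<open>
  \<open>monomial_divdiff c b k\<close> is the divided difference of the monomial \<open>y ^ b\<close> at the nodes \<open>c 0, \<dots>, c k\<close>, that is, the
  complete homogeneous symmetric polynomial of degree \<open>b - k\<close> in these nodes.  The recursion is the
  Leibniz rule for the product of \<open>y\<close> and \<open>y ^ b\<close>; it stays inside the ring of the nodes, which allows
  nodes in a polynomial ring.
\<close>

fun monomial_divdiff :: "(nat \<Rightarrow> 'a::comm_ring_1) \<Rightarrow> nat \<Rightarrow> nat \<Rightarrow> 'a" where
  "monomial_divdiff c 0 0 = 1"
| "monomial_divdiff c 0 (Suc k) = 0"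
| "monomial_divdiff c (Suc b) 0 = c 0 * monomial_divdiff c b 0"
| "monomial_divdiff c (Suc b) (Suc k) = c (Suc k) * monomial_divdiff c b (Suc k) + monomial_divdiff c b k"

definition newton_basis :: "(nat \<Rightarrow> 'a::comm_ring_1) \<Rightarrow> nat \<Rightarrow> 'a \<Rightarrow> 'a" where
  "newton_basis c k y = (\<Prod>i<k. y - c i)"

lemma monomial_divdiff_eq_0: "b < k \<Longrightarrow> monomial_divdiff c b k = 0"
  by (induction c b k rule: monomial_divdiff.induct) auto

lemma monomial_divdiff_diag: "monomial_divdiff c b b = 1"
  by (induction b) (auto simp: monomial_divdiff_eq_0)

lemma newton_basis_Suc: "newton_basis c (Suc k) y = newton_basis c k y * (y - c k)"
  by (simp add: newton_basis_def)

lemma newton_basis_node: "j < k \<Longrightarrow> newton_basis c k (c j) = 0"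
  unfolding newton_basis_def by (rule prod_zero) auto

text \<open>
  Multiplication with \<open>y = c k + (y - c k)\<close> maps the \<open>k\<close>-th Newton polynomial to \<open>c k\<close> times itself plus its
  successor, which is the recursion of \<open>monomial_divdiff\<close>.
\<close>

lemma newton_interpolation: "y ^ b = (\<Sum>k\<le>b. monomial_divdiff c b k * newton_basis c k y)"
proof (induction b)
  case 0 show ?case by (simp add: newton_basis_def)
next
  case (Suc b)
  let ?N = "\<lambda>k. newton_basis c k y"
  have "(\<Sum>k\<le>Suc b. monomial_divdiff c (Suc b) k * ?N k)
      = c 0 * monomial_divdiff c b 0 * ?N 0 + (\<Sum>k\<le>b. (c (Suc k) * monomial_divdiff c b (Suc k) + monomial_divdiff c b k) * ?N (Suc k))"
    by (subst sum.atMost_Suc_shift) simp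
  also have "\<dots> = (c 0 * monomial_divdiff c b 0 * ?N 0 + (\<Sum>k\<le>b. c (Suc k) * monomial_divdiff c b (Suc k) * ?N (Suc k)))
       + (\<Sum>k\<le>b. monomial_divdiff c b k * ?N (Suc k))"
    by (simp add: algebra_simps sum.distrib)
  also have "c 0 * monomial_divdiff c b 0 * ?N 0 + (\<Sum>k\<le>b. c (Suc k) * monomial_divdiff c b (Suc k) * ?N (Suc k))
       = (\<Sum>k\<le>Suc b. c k * monomial_divdiff c b k * ?N k)"
    by (simp add: sum.atMost_Suc_shift del: sum.atMost_Suc)
  also have "\<dots> = (\<Sum>k\<le>b. c k * monomial_divdiff c b k * ?N k)" by (simp add: monomial_divdiff_eq_0)
  also have "\<dots> + (\<Sum>k\<le>b. monomial_divdiff c b k * ?N (Suc k)) = (\<Sum>k\<le>b. monomial_divdiff c b k * ?N k * y)"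
    by (simp add: sum.distrib [symmetric] newton_basis_Suc algebra_simps)
  also have "\<dots> = y ^ b * y" by (simp add: Suc.IH sum_distrib_right)
  finally show ?case by (simp add: mult.commute)
qed

lemma monomial_divdiff_const_1: "monomial_divdiff (\<lambda>_. 1) b k = of_nat (b choose k)"
  by (induction "\<lambda>_::nat. 1::'a" b k rule: monomial_divdiff.induct) auto

lemma poly_monomial_divdiff: "poly (monomial_divdiff c b k) z = monomial_divdiff (\<lambda>i. poly (c i) z) b k"
  by (induction c b k rule: monomial_divdiff.induct) auto

lemma integral_monomial_divdiff: "(\<And>i. integral_poly (c i)) \<Longrightarrow> integral_poly (monomial_divdiff c b k)"
  by (induction c b k rule: monomial_divdiff.induct) (auto intro: integral_poly_add integral_poly_mult)

text \<open>
  Newton's formula becomes a finite matrix product: the terms with \<open>k > b\<close> vanish through the divided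
  difference, and at the node \<open>c j\<close> those with \<open>k > j\<close> vanish through the Newton polynomial.
\<close>

lemma newton_interpolation_trunc:
  assumes "b < n \<or> (\<exists>j<n. y = c j)"
  shows "y ^ b = (\<Sum>k<n. monomial_divdiff c b k * newton_basis c k y)" 
proof -
  have "(\<Sum>k\<le>b. monomial_divdiff c b k * newton_basis c k y) = (\<Sum>k\<in>{..b} \<union> {..<n}. monomial_divdiff c b k * newton_basis c k y)"
    by (rule sum.mono_neutral_left) (auto simp: monomial_divdiff_eq_0)
  also have "\<dots> = (\<Sum>k<n. monomial_divdiff c b k * newton_basis c k y)"
    using assms by (intro sum.mono_neutral_right) (auto, metis le_less_trans mult_zero_right newton_basis_node not_le)
  finally show ?thesis using newton_interpolation[of y b c] by simp
qed


lemma poly_det: "poly (det A) z = det (\<chi> i j. poly (A $ i $ j) z)"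
  for A :: "'a::comm_ring_1 poly ^'n^'n"
  by (simp add: det_def poly_sum poly_prod)

lemma integral_det:
  assumes "\<And>i j. integral_poly (A $ i $ j)"
  shows "integral_poly (det A)"
  unfolding det_def
  by (intro integral_poly_sum integral_poly_mult integral_poly_prod assms) simp

text \<open>
  The position of an index numbers the rows and columns of a matrix from 0, so that sequences of
  nodes can be indexed by natural numbers and Newton's formula gives triangular matrices.
\<close>

definition rank :: "'n::{finite,wellorder} \<Rightarrow> nat" where
  "rank i = card {..<i}"

lemma rank_less_iff [simp]: "rank i < rank j \<longleftrightarrow> i < j"
proof -
  have "rank i < rank j" if "i < j" for i j :: "'n::{finite,wellorder}"
    unfolding rank_def using that by (intro psubset_card_mono) auto
  then show ?thesis by (metis not_less_iff_gr_or_eq)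
qed

lemma bij_rank: "bij_betw rank (UNIV :: 'n::{finite,wellorder} set) {..<CARD('n::{finite,wellorder})}"
proof -
  have inj: "inj (rank :: 'n \<Rightarrow> nat)"
    by (rule injI) (metis rank_less_iff less_irrefl neqE)
  have "rank i < CARD('n)" for i :: 'n
    unfolding rank_def by (rule psubset_card_mono) auto
  then have "range (rank :: 'n \<Rightarrow> nat) = {..<CARD('n)}"
    by (intro card_subset_eq) (auto simp: card_image[OF inj])
  with inj show ?thesis by (simp add: bij_betw_def)
qed

lemma sum_rank: "(\<Sum>k\<in>(UNIV :: 'n::{finite,wellorder} set). f (rank k)) = (\<Sum>k<CARD('n::{finite,wellorder}). f k)"
  by (rule sum.reindex_bij_betw[OF bij_rank])

lemma rank_less_CARD: "rank (i :: 'n::{finite,wellorder}) < CARD('n::{finite,wellorder})"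
  using bij_rank[where 'n='n] by (auto simp: bij_betw_def)

lemma rank_surj:
  assumes "k < CARD('n::{finite,wellorder})"
  obtains i :: "'n::{finite,wellorder}" where "k = rank i"
proof -
  have "k \<in> range (rank :: 'n \<Rightarrow> nat)"
    using bij_rank[where 'n='n] assms by (simp add: bij_betw_def)
  then show ?thesis using that by auto
qed

text \<open>
  A generalized Vandermonde determinant is the Vandermonde determinant of the nodes times a determinant
  that is polynomial in the nodes (for distinct exponents, a Schur polynomial up to sign): Newton's
  formula factors the matrix, and the
  matrix of Newton polynomials at their own nodes is triangular.
\<close>

lemma det_power_matrix:
  fixes c :: "nat \<Rightarrow> 'a::comm_ring_1" and b :: "'n::{finite,wellorder} \<Rightarrow> nat"
  shows "det (\<chi> j l. c (rank j) ^ b l :: 'a^'n::_^'n::_)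
    = (\<Prod>j\<in>UNIV. newton_basis c (rank (j::'n)) (c (rank j))) * det (\<chi> k l. monomial_divdiff c (b l) (rank k) :: 'a^'n::_^'n::_)"
proof -
  let ?N = "\<chi> j k. newton_basis c (rank k) (c (rank j)) :: 'a^'n::_^'n::_"
  let ?F = "\<chi> k l. monomial_divdiff c (b l) (rank k) :: 'a^'n::_^'n::_"
  have "(\<chi> j l. c (rank j) ^ b l :: 'a^'n::_^'n::_) = ?N ** ?F"
  proof -
    have "c (rank j) ^ b l = (\<Sum>k<CARD('n). monomial_divdiff c (b l) k * newton_basis c k (c (rank j)))" for j l :: 'n
      by (rule newton_interpolation_trunc) (use rank_less_CARD[of j] in auto)
    then show ?thesis
      by (simp add: vec_eq_iff matrix_matrix_mult_def sum_rank[symmetric] mult.commute)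
  qed
  moreover have "det ?N = (\<Prod>j\<in>UNIV. newton_basis c (rank (j::'n)) (c (rank j)))"
    by (subst det_lowerdiagonal) (auto simp: newton_basis_node)
  ultimately show ?thesis by (simp add: det_mul)
qed

text \<open>
  Newton polynomials and monomials are related by a unitriangular matrix, whatever the nodes are.
\<close>

lemma det_newton_basis:
  fixes c :: "nat \<Rightarrow> 'a::comm_ring_1" and y :: "'n::{finite,wellorder} \<Rightarrow> 'a"
  shows "det (\<chi> l k. newton_basis c (rank k) (y l) :: 'a^'n::_^'n::_) = det (\<chi> l k. y l ^ rank k :: 'a^'n::_^'n::_)"
proof -
  let ?N = "\<chi> l k. newton_basis c (rank k) (y l) :: 'a^'n::_^'n::_"
  let ?F = "\<chi> k m. monomial_divdiff c (rank m) (rank k) :: 'a^'n::_^'n::_"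
  have "(\<chi> l m. y l ^ rank m :: 'a^'n::_^'n::_) = ?N ** ?F"
  proof -
    have "y l ^ rank m = (\<Sum>k<CARD('n). monomial_divdiff c (rank m) k * newton_basis c k (y l))" for l m :: 'n
      by (rule newton_interpolation_trunc) (use rank_less_CARD[of m] in auto)
    then show ?thesis
      by (simp add: vec_eq_iff matrix_matrix_mult_def sum_rank[symmetric] mult.commute)
  qed
  moreover have "det ?F = 1"
    by (subst det_upperdiagonal) (auto simp: monomial_divdiff_eq_0 monomial_divdiff_diag)
  ultimately show ?thesis by (simp add: det_mul)
qed

lemma newton_basis_of_nat:
  "newton_basis of_nat k (of_nat b :: 'a::field_char_0) = fact k * of_nat (b choose k)"
  by (simp add: newton_basis_def binomial_gbinomial gbinomial_mult_fact atLeast0LessThan)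

text \<open>
  The falling factorials \<open>fact k * (b choose k)\<close> are the Newton polynomials at the nodes \<open>0, 1, 2, \<dots>\<close>.  By
  \<open>det_newton_basis\<close> the nodes may be exchanged for the \<open>b l\<close> themselves, which makes the matrix triangular,
  and the determinant is the product of the differences of the \<open>b l\<close>.
\<close>

lemma det_binomial:
  fixes b :: "'n::{finite,wellorder} \<Rightarrow> nat" and x :: "nat \<Rightarrow> complex"
  assumes "\<And>l. x (rank l) = of_nat (b l)"
  shows "(\<Prod>k\<in>(UNIV :: 'n set). fact (rank k)) * det (\<chi> k l. of_nat (b l choose rank k) :: complex^'n::_^'n::_)
    = (\<Prod>l\<in>UNIV. newton_basis x (rank l) (of_nat (b l)))"
proof -
  have "(\<Prod>k\<in>(UNIV :: 'n set). fact (rank k)) * det (\<chi> k l. of_nat (b l choose rank k) :: complex^'n::_^'n::_)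
      = det (\<chi> k. fact (rank k) *s (\<chi> l. of_nat (b l choose rank k)) :: complex^'n::_^'n::_)"
    by (subst det_rows_mul) simp
  also have "\<dots> = det (transpose (\<chi> l k. newton_basis of_nat (rank k) (of_nat (b l))) :: complex^'n::_^'n::_)"
    by (rule arg_cong[where f=det])
       (simp add: vec_eq_iff transpose_def newton_basis_of_nat)
  also have "\<dots> = det (\<chi> l k. newton_basis x (rank k) (of_nat (b l)) :: complex^'n::_^'n::_)"
    by (simp only: det_transpose det_newton_basis)
  also have "\<dots> = (\<Prod>l\<in>UNIV. newton_basis x (rank l) (of_nat (b l)))"
    by (subst det_lowerdiagonal) (auto simp: newton_basis_node simp flip: assms)
  finally show ?thesis .
qed

text \<open>
  Write \<open>e i = \<zeta> ^ a i\<close> and take \<open>x ^ a i\<close> as nodes in \<open>\<int>[x]\<close>.  At \<open>x = \<zeta>\<close> the nodes are distinct and the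
  Vandermonde factor of the determinant is not zero.  If the other factor \<open>Q(x)\<close> vanished at \<open>\<zeta>\<close>, then \<open>p\<close> would
  divide \<open>Q(1)\<close>.  But at \<open>x = 1\<close> all nodes are 1, the divided differences are binomial coefficients, and
  \<open>Q(1)\<close> divides the product of the differences of the exponents \<open>b j\<close>, which is prime to \<open>p\<close>.
\<close>

theorem chebotarev:
  fixes e :: "'n::{finite,wellorder} \<Rightarrow> complex" and b :: "'n \<Rightarrow> nat"
  assumes p: "prime p"
    and e: "inj e" "\<And>i. e i ^ p = 1" and b: "inj b" "\<And>i. b i < p"
  shows "det (\<chi> i j. e i ^ b j) \<noteq> 0"
proof
  assume det0: "det (\<chi> i j. e i ^ b j) = 0"
  obtain \<zeta> :: complex where \<zeta>: "\<zeta> ^ p = 1" "\<zeta> \<noteq> 1"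
    using primitive_unity_root_exists[OF p] .
  define r where "r = (inv_into UNIV rank :: nat \<Rightarrow> 'n)"
  have r: "r (rank i) = i" for i
    unfolding r_def using bij_rank[where 'n='n] by (auto simp: bij_betw_def)
  have "e i \<in> (\<lambda>k. \<zeta> ^ k) ` {..<p}" for i
    using unity_roots_eq_powers[OF p \<zeta>] e(2)[of i] by (simp add: bij_betw_def)
  then have "\<exists>k. e i = \<zeta> ^ k" for i by (meson imageE)
  then obtain a where a: "e i = \<zeta> ^ a i" for i by metis
  define c where "c = (\<lambda>k. Polynomial.monom (1::complex) (a (r k)))"
  have c: "poly (c (rank i)) \<zeta> = e i" "poly (c k) 1 = 1" for i k
    by (simp_all add: c_def r a poly_monom)
  define F where "F = (\<chi> k l. monomial_divdiff c (b l) (rank k) :: complex poly^'n::_^'n::_)"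
  have "integral_poly (det F)"
    unfolding F_def by (intro integral_det) (auto simp: c_def intro!: integral_monomial_divdiff)
  then obtain q where q: "poly (det F) 1 = of_int q" by (rule integral_poly_eval_1)
  have "(\<Prod>j\<in>UNIV. newton_basis (\<lambda>k. poly (c k) \<zeta>) (rank (j::'n)) (e j)) * poly (det F) \<zeta> = 0"
    using det0 det_power_matrix[of "\<lambda>k. poly (c k) \<zeta>" b]
    by (simp add: c poly_det F_def poly_monomial_divdiff)
  moreover have "newton_basis (\<lambda>k. poly (c k) \<zeta>) (rank j) (e j) \<noteq> 0" for j
  proof -
    have "e j \<noteq> poly (c i) \<zeta>" if "i < rank j" for i
    proof -
      have "i < CARD('n)" using that rank_less_CARD[of j] by simp
      then obtain i' :: 'n where "i = rank i'" by (rule rank_surj)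
      then show ?thesis using that e(1) by (auto simp: c dest: injD)
    qed
    then show ?thesis by (auto simp: newton_basis_def)
  qed
  ultimately have "poly (det F) \<zeta> = 0" by simp
  from prime_dvd_eval_1[OF p \<open>integral_poly (det F)\<close> \<zeta> this q]
  have "int p dvd q" .
  define x where "x = (\<lambda>k. b (r k))"
  have "of_int q = det (\<chi> k l. of_nat (b l choose rank k) :: complex^'n::_^'n::_)"
    by (simp flip: q add: F_def poly_det poly_monomial_divdiff c monomial_divdiff_const_1)
  then have "(\<Prod>k\<in>(UNIV :: 'n set). fact (rank k)) * of_int q = (\<Prod>l\<in>UNIV. newton_basis (\<lambda>k. of_nat (x k)) (rank l) (of_nat (b l) :: complex))"
    using det_binomial[of "\<lambda>k. of_nat (x k)" b] by (simp add: x_def r)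
  then have "(of_int ((\<Prod>k\<in>(UNIV :: 'n set). fact (rank k)) * q) :: complex) = of_int (\<Prod>l\<in>(UNIV :: 'n set). \<Prod>i<rank l. int (b l) - int (x i))"
    by (simp add: newton_basis_def)
  then have "(\<Prod>k\<in>(UNIV :: 'n set). fact (rank k)) * q = (\<Prod>l\<in>(UNIV :: 'n set). \<Prod>i<rank l. int (b l) - int (x i))"
    using of_int_eq_iff by blast
  with \<open>int p dvd q\<close> have "int p dvd (\<Prod>l\<in>(UNIV :: 'n set). \<Prod>i<rank l. int (b l) - int (x i))"
    by (metis dvd_mult)
  moreover have "prime (int p)" using p by simp
  ultimately obtain l i where li: "i < rank (l::'n)" "int p dvd int (b l) - int (x i)"
    by (auto simp: prime_dvd_prod_iff)
  then have "i < CARD('n)" using rank_less_CARD[of l] by simp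
  then obtain i' :: 'n where i': "i = rank i'" by (rule rank_surj)
  have "[int (b l) = int (b i')] (mod int p)"
    using li(2) by (simp add: x_def i' r cong_iff_dvd_diff)
  then have "b l = b i'"
    using b(2) by (simp add: cong_int_iff cong_less_modulus_unique_nat)
  then show False using b(1) li(1) i' by (auto dest: injD)
qed

section \<open>Orbits of the power maps on sets of roots of unity\<close>

lemma finite_unity_roots: "prime p \<Longrightarrow> finite (unity_roots p)"
  using finite_roots_unity[of p] prime_gt_0_nat[of p] by simp

lemma root_power_mod:
  fixes z :: complex
  assumes "z ^ p = 1"
  shows "z ^ (k mod p) = z ^ k"
proof -
  have "z ^ k = z ^ (p * (k div p) + k mod p)" by simp
  then show ?thesis using assms by (simp only: power_add power_mult) simp
qed

lemma root_power_cong: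
  fixes z :: complex
  assumes "z ^ p = 1" "[k = l] (mod p)"
  shows "z ^ k = z ^ l"
  using root_power_mod[OF assms(1)] assms(2) by (metis cong_def)

lemma prime_totatives_iff: "prime p \<Longrightarrow> k \<in> totatives p \<longleftrightarrow> 0 < k \<and> k < p"
  by (auto simp: totatives_prime)

definition power_units :: "nat \<Rightarrow> nat monoid" where
  "power_units p = \<lparr>carrier = totatives p, monoid.mult = (\<lambda>k l. k * l mod p), one = 1\<rparr>"

text \<open>
  If \<open>p\<close> does not divide \<open>n\<close>, the condition on the product selects one representative from each class of
  \<open>n\<close>-element sets modulo multiplication with \<open>p\<close>-th roots of unity.
\<close>

definition root_sets :: "nat \<Rightarrow> nat \<Rightarrow> complex set set" where
  "root_sets p n = {E. E \<subseteq> unity_roots p \<and> card E = n \<and> \<Prod>E = 1}"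

definition power_action :: "nat \<Rightarrow> nat \<Rightarrow> nat \<Rightarrow> complex set \<Rightarrow> complex set" where
  "power_action p n k = (\<lambda>E\<in>root_sets p n. (\<lambda>z. z ^ k) ` E)"

lemma group_power_units:
  assumes "prime p"
  shows "group (power_units p)"
proof (rule groupI)
  have p1: "p > 1" using assms prime_gt_1_nat by blast
  fix k l m assume k: "k \<in> carrier (power_units p)" and l: "l \<in> carrier (power_units p)"
    and m: "m \<in> carrier (power_units p)"
  then have kl: "coprime (k * l) p" by (auto simp: power_units_def totatives_def)
  then show "k \<otimes>\<^bsub>power_units p\<^esub> l \<in> carrier (power_units p)"
    using p1 assms coprime_common_divisor_nat[of "k * l" p p]
    by (auto simp: power_units_def prime_totatives_iff mod_greater_zero_iff_not_dvd simp del: coprime_mult_left_iff)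
  show "\<one>\<^bsub>power_units p\<^esub> \<otimes>\<^bsub>power_units p\<^esub> k = k"
    using k by (auto simp: power_units_def prime_totatives_iff assms)
  show "k \<otimes>\<^bsub>power_units p\<^esub> l \<otimes>\<^bsub>power_units p\<^esub> m = k \<otimes>\<^bsub>power_units p\<^esub> (l \<otimes>\<^bsub>power_units p\<^esub> m)"
    by (simp add: power_units_def mod_mult_left_eq mod_mult_right_eq mult.assoc)
  have "coprime k p" using k by (auto simp: power_units_def totatives_def)
  then obtain j where j: "[k * j = 1] (mod p)" using cong_solve_coprime_nat[of k p] by auto
  have "j mod p \<in> totatives p"
  proof -
    have "\<not> p dvd j" using j p1 by (metis cong_dvd_iff dvd_mult nat_dvd_1_iff_1 less_irrefl)
    then show ?thesis using p1 by (simp add: prime_totatives_iff assms mod_greater_zero_iff_not_dvd)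
  qed
  moreover have "j mod p * k mod p = 1"
    using j p1 unfolding mod_mult_left_eq by (simp add: cong_def mult.commute)
  ultimately show "\<exists>j\<in>carrier (power_units p). j \<otimes>\<^bsub>power_units p\<^esub> k = \<one>\<^bsub>power_units p\<^esub>"
    by (auto simp: power_units_def)
next
  show "\<one>\<^bsub>power_units p\<^esub> \<in> carrier (power_units p)"
    using prime_gt_1_nat[OF assms] by (auto simp: power_units_def prime_totatives_iff assms)
qed

lemma power_image_root_sets:
  assumes "prime p" "\<not> p dvd k" "E \<in> root_sets p n"
  shows "(\<lambda>z. z ^ k) ` E \<in> root_sets p n"
proof -
  have E: "E \<subseteq> unity_roots p" using assms(3) by (simp add: root_sets_def)
  have inj: "inj_on (\<lambda>z. z ^ k) E"
    using inj_on_subset[OF inj_on_power_unity_roots[OF assms(1,2)] E] .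
  have "(\<lambda>z. z ^ k) ` E \<subseteq> unity_roots p"
    using E power_image_unity_roots[OF assms(1,2)] by blast
  moreover have "\<Prod>((\<lambda>z. z ^ k) ` E) = (\<Prod>E) ^ k"
    by (simp add: prod.reindex[OF inj] prod_power_distrib)
  ultimately show ?thesis
    using assms(3) by (simp add: root_sets_def card_image[OF inj])
qed

lemma power_action_group_action:
  assumes "prime p"
  shows "group_action (power_units p) (root_sets p n) (power_action p n)"
proof -
  have Bij: "power_action p n k \<in> Bij (root_sets p n)" if "k \<in> totatives p" for k
  proof -
    have k: "\<not> p dvd k" using that assms by (auto simp: prime_totatives_iff dest: dvd_imp_le)
    have "inj_on (\<lambda>E. (\<lambda>z. z ^ k) ` E) (root_sets p n)"
      by (rule inj_onI)
         (use inj_on_image_eq_iff[OF inj_on_power_unity_roots[OF assms k]] in \<open>auto simp: root_sets_def\<close>)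
    moreover have "(\<lambda>E. (\<lambda>z. z ^ k) ` E) ` root_sets p n \<subseteq> root_sets p n"
      using power_image_root_sets[OF assms k] by auto
    moreover have "finite (root_sets p n)"
      unfolding root_sets_def using finite_unity_roots[OF assms] by (auto intro: finite_subset[of _ "Pow (unity_roots p)"])
    ultimately have "bij_betw (\<lambda>E. (\<lambda>z. z ^ k) ` E) (root_sets p n) (root_sets p n)"
      by (simp add: bij_betw_def endo_inj_surj)
    then show ?thesis by (auto simp: Bij_def power_action_def cong: bij_betw_cong)
  qed
  have "power_action p n (k * l mod p) = compose (root_sets p n) (power_action p n k) (power_action p n l)"
    if "k \<in> totatives p" "l \<in> totatives p" for k l
  proof -
    have l: "\<not> p dvd l" using that assms by (auto simp: prime_totatives_iff dest: dvd_imp_le)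
    have "(\<lambda>z. z ^ (k * l mod p)) ` E = (\<lambda>z. z ^ k) ` (\<lambda>z. z ^ l) ` E" if "E \<in> root_sets p n" for E
      unfolding image_image
      by (rule image_cong) (use that in \<open>auto simp: root_power_mod root_sets_def mult.commute simp flip: power_mult\<close>)
    then show ?thesis
      using power_image_root_sets[OF assms l] by (auto simp: fun_eq_iff power_action_def compose_def)
  qed
  then have "power_action p n \<in> hom (power_units p) (BijGroup (root_sets p n))"
    using Bij by (auto simp: hom_def BijGroup_def power_units_def)
  then show ?thesis
    unfolding group_action_def group_hom_def group_hom_axioms_def
    using group_power_units[OF assms] group_BijGroup by blast
qed

text \<open>
  A subset of \<open>Y\<close> that contains every block it meets is the same as a choice of blocks.
\<close>

lemma card_saturated_subsets:
  assumes Y: "finite Y" and P: "partition_on Y P" and d: "\<And>B. B \<in> P \<Longrightarrow> card B = d" "d > 0"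
  shows "card {E. E \<subseteq> Y \<and> card E = s \<and> (\<forall>B\<in>P. B \<subseteq> E \<or> B \<inter> E = {})}
    = (if d dvd s then card P choose (s div d) else 0)" (is "card ?S = _")
proof -
  have finP: "finite P" using finite_elements[OF Y P] .
  have card_Union: "card (\<Union>A) = d * card A" if "A \<subseteq> P" for A
  proof -
    have "card (\<Union>A) = sum card A"
      using that P Y by (intro card_Union_disjoint)
        (auto simp: partition_on_def pairwise_def disjoint_def disjnt_def intro: finite_subset[OF Union_upper])
    also have "\<dots> = (\<Sum>B\<in>A. d)" using that d by (intro sum.cong) auto
    finally show ?thesis by simp
  qed
  have disj: "B = B'" if "B \<in> P" "B' \<in> P" "x \<in> B" "x \<in> B'" for B B' x
    using P that by (auto simp: partition_on_def disjoint_def)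
  have ne: "B \<noteq> {}" if "B \<in> P" for B using that d by fastforce
  have "bij_betw Union {A. A \<subseteq> P \<and> d * card A = s} ?S"
  proof (rule bij_betwI[where g = "\<lambda>E. {B \<in> P. B \<subseteq> E}"])
    show "Union \<in> {A. A \<subseteq> P \<and> d * card A = s} \<rightarrow> ?S"
    proof
      fix A assume "A \<in> {A. A \<subseteq> P \<and> d * card A = s}"
      then have A: "A \<subseteq> P" "d * card A = s" by auto
      have "\<Union>A \<subseteq> Y" using A P by (auto simp: partition_on_def)
      moreover have "B \<subseteq> \<Union>A \<or> B \<inter> \<Union>A = {}" if "B \<in> P" for B
        using that A(1) disj by blast
      ultimately show "\<Union>A \<in> ?S" using A card_Union by auto
    qed
    have eq: "\<Union>{B \<in> P. B \<subseteq> E} = E" if "E \<in> ?S" for E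
    proof
      show "E \<subseteq> \<Union>{B \<in> P. B \<subseteq> E}"
      proof
        fix x assume x: "x \<in> E"
        then have "x \<in> \<Union>P" using that P by (auto simp: partition_on_def)
        then obtain B where "B \<in> P" "x \<in> B" by auto
        then show "x \<in> \<Union>{B \<in> P. B \<subseteq> E}" using that x by auto
      qed
    qed auto
    then show "\<And>E. E \<in> ?S \<Longrightarrow> \<Union>{B \<in> P. B \<subseteq> E} = E" .
    show "(\<lambda>E. {B \<in> P. B \<subseteq> E}) \<in> ?S \<rightarrow> {A. A \<subseteq> P \<and> d * card A = s}"
    proof
      fix E assume E: "E \<in> ?S"
      then have "d * card {B \<in> P. B \<subseteq> E} = s"
        using card_Union[of "{B \<in> P. B \<subseteq> E}"] eq[OF E] by auto
      then show "{B \<in> P. B \<subseteq> E} \<in> {A. A \<subseteq> P \<and> d * card A = s}" by auto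
    qed
    fix A assume "A \<in> {A. A \<subseteq> P \<and> d * card A = s}"
    then have A: "A \<subseteq> P" by auto
    show "{B \<in> P. B \<subseteq> \<Union>A} = A"
    proof
      show "{B \<in> P. B \<subseteq> \<Union>A} \<subseteq> A"
      proof
        fix B assume B: "B \<in> {B \<in> P. B \<subseteq> \<Union>A}"
        then obtain x where "x \<in> B" using ne by auto
        with B obtain B' where "B' \<in> A" "x \<in> B'" by auto
        then show "B \<in> A" using B A disj \<open>x \<in> B\<close> by auto
      qed
    qed (use A in auto)
  qed
  then have "card ?S = card {A. A \<subseteq> P \<and> d * card A = s}" by (simp add: bij_betw_same_card)
  also have "\<dots> = (if d dvd s then card P choose (s div d) else 0)"
  proof (cases "d dvd s")
    case True
    then have "d * c = s \<longleftrightarrow> c = s div d" for c using d(2) by auto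
    then show ?thesis using True n_subsets[OF finP] by simp
  next
    case False
    then have "{A. A \<subseteq> P \<and> d * card A = s} = {}" by auto
    then have "card {A. A \<subseteq> P \<and> d * card A = s} = 0" by (simp only: card.empty)
    then show ?thesis using False by simp
  qed
  finally show ?thesis .
qed

text \<open>
  The powers of \<open>k\<close> act freely on the nontrivial roots of unity, so these are partitioned into orbits of
  size \<open>ord p k\<close>, and the invariant sets are the unions of orbits.
\<close>

lemma card_power_invariant_aux:
  assumes p: "prime p" and k: "k \<in> totatives p" and d: "ord p k = d"
  shows "card {E. E \<subseteq> unity_roots p - {1} \<and> card E = s \<and> (\<lambda>z. z ^ k) ` E = E}
    = (if d dvd s then ((p - 1) div d) choose (s div d) else 0)"
proof -
  let ?Y = "unity_roots p - {1}"
  define orb where "orb z = {z ^ (k ^ i) | i. True}" for z :: complex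
  have cop: "coprime p k" using k by (simp add: totatives_def coprime_commute)
  have d0: "d > 0" using ord_eq_0[of p k] cop d by auto
  have kd: "[k ^ d = 1] (mod p)" using ord[of k p] d by simp
  have ndvd: "\<not> p dvd k ^ i" for i
    using cop p by (metis coprime_absorb_left coprime_power_right_iff not_prime_unit)
  have orb_Y: "z ^ (k ^ i) \<in> ?Y" if "z \<in> ?Y" for z i
  proof -
    have "(z ^ (k ^ i)) ^ p = (z ^ p) ^ (k ^ i)" by (simp add: mult.commute flip: power_mult)
    then have "(z ^ (k ^ i)) ^ p = 1" using that by simp
    then show ?thesis using that root_power_eq_1_iff[OF p, of z "k ^ i"] ndvd by auto
  qed
  have orb_refl: "z \<in> orb z" for z unfolding orb_def by (rule CollectI, rule exI[of _ 0]) simp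
  have orb_sub: "orb w \<subseteq> orb z" if "w \<in> orb z" for w z
    using that by (auto simp: orb_def simp flip: power_mult power_add)
  have orb_sym: "z \<in> orb w" if "z \<in> ?Y" "w \<in> orb z" for w z
  proof -
    from that(2) obtain i where i: "w = z ^ (k ^ i)" unfolding orb_def by blast
    \<comment> \<open>Applying the action another \<open>d * i - i\<close> times leads back to \<open>z\<close>, since \<open>k ^ d\<close> is 1 modulo \<open>p\<close>.\<close>
    have "i + (d * i - i) = d * i" using d0 by (cases d) auto
    then have "w ^ (k ^ (d * i - i)) = z ^ (k ^ (d * i))"
      by (simp add: i flip: power_mult power_add)
    also have "\<dots> = z ^ 1"
      using that(1) cong_pow[OF kd, of i] by (intro root_power_cong[of z p]) (auto simp: power_mult)
    finally show ?thesis unfolding orb_def by auto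
  qed
  have orb_eq: "orb w = orb z" if "z \<in> ?Y" "w \<in> orb z" for w z
    using orb_sub[OF that(2)] orb_sub[OF orb_sym[OF that]] by blast
  have orb_card: "card (orb z) = d" if z: "z \<in> ?Y" for z
  proof -
    have iff: "z ^ (k ^ i) = z ^ (k ^ j) \<longleftrightarrow> [i = j] (mod d)" for i j
      using z root_power_eq_iff[OF p, of z "k ^ i" "k ^ j"] order_divides_expdiff[OF cop, of i j] d by auto
    have "orb z = (\<lambda>i. z ^ (k ^ i)) ` {..<d}"
    proof
      show "orb z \<subseteq> (\<lambda>i. z ^ (k ^ i)) ` {..<d}"
      proof
        fix w assume "w \<in> orb z"
        then obtain i where "w = z ^ (k ^ i)" by (auto simp: orb_def)
        also have "\<dots> = z ^ (k ^ (i mod d))" by (simp add: iff)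
        finally show "w \<in> (\<lambda>i. z ^ (k ^ i)) ` {..<d}" using d0 by auto
      qed
    qed (auto simp: orb_def)
    moreover have "inj_on (\<lambda>i. z ^ (k ^ i)) {..<d}"
      by (rule inj_onI) (auto simp: iff cong_less_modulus_unique_nat)
    ultimately show ?thesis by (simp add: card_image)
  qed
  define P where "P = orb ` ?Y"
  have fin: "finite ?Y" using finite_unity_roots[OF p] by simp
  have P: "partition_on ?Y P"
  proof (rule partition_onI)
    show "\<Union>P = ?Y" using orb_Y orb_refl unfolding P_def by (fastforce simp: orb_def)
    show "disjnt B B'" if B: "B \<in> P" "B' \<in> P" "B \<noteq> B'" for B B'
    proof (rule ccontr)
      assume "\<not> disjnt B B'"
      then obtain w where w: "w \<in> B" "w \<in> B'" by (auto simp: disjnt_def)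
      obtain z z' where "z \<in> ?Y" "B = orb z" "z' \<in> ?Y" "B' = orb z'" using B by (auto simp: P_def)
      then show False using orb_eq w B(3) by metis
    qed
    show "{} \<notin> P" using orb_refl by (auto simp: P_def)
  qed
  have Pd: "card B = d" if "B \<in> P" for B using that orb_card by (auto simp: P_def)
  have "card ?Y = d * card P"
    using card_partition[of P d] P fin Pd finite_elements[OF fin P]
    by (auto simp: partition_on_def disjoint_def)
  moreover have "card ?Y = p - 1"
    using card_roots_unity_eq[of p] prime_gt_0_nat[OF p] finite_unity_roots[OF p] by (simp add: card_Diff_singleton)
  ultimately have cardP: "card P = (p - 1) div d" using d0 by auto
  have "(\<lambda>z. z ^ k) ` E = E \<longleftrightarrow> (\<forall>B\<in>P. B \<subseteq> E \<or> B \<inter> E = {})" if E: "E \<subseteq> ?Y" for E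
  proof
    assume inv: "(\<lambda>z. z ^ k) ` E = E"
    have pow: "z ^ (k ^ i) \<in> E" if "z \<in> E" for z i
    proof (induction i)
      case (Suc i)
      then have "(z ^ (k ^ i)) ^ k \<in> E" using inv by blast
      then show ?case by (simp add: mult.commute flip: power_mult)
    qed (use that in simp)
    show "\<forall>B\<in>P. B \<subseteq> E \<or> B \<inter> E = {}"
    proof
      fix B assume "B \<in> P"
      then obtain z where z: "z \<in> ?Y" "B = orb z" by (auto simp: P_def)
      have "B \<subseteq> E" if "w \<in> B" "w \<in> E" for w
      proof -
        have "B = orb w" using orb_eq z that by simp
        then show ?thesis using pow[OF that(2)] by (auto simp: orb_def)
      qed
      then show "B \<subseteq> E \<or> B \<inter> E = {}" by blast
    qed
  next
    assume sat: "\<forall>B\<in>P. B \<subseteq> E \<or> B \<inter> E = {}"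
    show "(\<lambda>z. z ^ k) ` E = E"
    proof (rule endo_inj_surj)
      show "finite E" using E fin finite_subset by blast
      show "inj_on (\<lambda>z. z ^ k) E"
        using inj_on_power_unity_roots[OF p ndvd[of 1]] E by (auto intro: inj_on_subset)
      show "(\<lambda>z. z ^ k) ` E \<subseteq> E"
      proof safe
        fix z assume z: "z \<in> E"
        then have "orb z \<in> P" "orb z \<inter> E \<noteq> {}" using E orb_refl by (auto simp: P_def)
        then have "orb z \<subseteq> E" using sat by auto
        moreover have "z ^ k \<in> orb z" unfolding orb_def by (rule CollectI, rule exI[of _ 1]) simp
        ultimately show "z ^ k \<in> E" by auto
      qed
    qed
  qed
  then have "{E. E \<subseteq> ?Y \<and> card E = s \<and> (\<lambda>z. z ^ k) ` E = E}
      = {E. E \<subseteq> ?Y \<and> card E = s \<and> (\<forall>B\<in>P. B \<subseteq> E \<or> B \<inter> E = {})}" by auto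
  then show ?thesis using card_saturated_subsets[OF fin P Pd d0, of s] cardP by simp
qed

text \<open>
  The root 1 is fixed by every power map, so an invariant set may contain it or not.
\<close>

lemma card_power_invariant:
  assumes p: "prime p" and k: "k \<in> totatives p" and d: "ord p k = d"
  shows "card {E. E \<subseteq> unity_roots p \<and> card E = Suc s \<and> (\<lambda>z. z ^ k) ` E = E}
    = (if d dvd Suc s then ((p - 1) div d) choose (Suc s div d) else 0)
     + (if d dvd s then ((p - 1) div d) choose (s div d) else 0)"
proof -
  let ?Y = "unity_roots p - {1}" and ?f = "\<lambda>E::complex set. (\<lambda>z. z ^ k) ` E"
  let ?A = "{E. E \<subseteq> ?Y \<and> card E = Suc s \<and> ?f E = E}"
  let ?B = "{E. E \<subseteq> ?Y \<and> card E = s \<and> ?f E = E}"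
  have fin: "finite E" if "E \<subseteq> unity_roots p" for E
    using that finite_unity_roots[OF p] finite_subset by blast
  have nd: "\<not> p dvd k" using k p by (auto simp: prime_totatives_iff dest: dvd_imp_le)
  have "{E. E \<subseteq> unity_roots p \<and> card E = Suc s \<and> ?f E = E} = ?A \<union> insert 1 ` ?B"
  proof (intro equalityI subsetI)
    fix E assume E: "E \<in> {E. E \<subseteq> unity_roots p \<and> card E = Suc s \<and> ?f E = E}"
    show "E \<in> ?A \<union> insert 1 ` ?B"
    proof (cases "1 \<in> E")
      case False then show ?thesis using E by auto
    next
      case True
      have "?f (E - {1}) = ?f E - ?f {1}"
        using E True inj_on_image_set_diff[OF inj_on_power_unity_roots[OF p nd], of E "{1}"] by auto
      then have "E - {1} \<in> ?B" using E True fin[of E] by auto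
      moreover have "E = insert 1 (E - {1})" using True by auto
      ultimately show ?thesis by blast
    qed
  next
    fix E assume "E \<in> ?A \<union> insert 1 ` ?B"
    then consider "E \<in> ?A" | E' where "E' \<in> ?B" "E = insert 1 E'" by blast
    then show "E \<in> {E. E \<subseteq> unity_roots p \<and> card E = Suc s \<and> ?f E = E}"
    proof cases
      case 2
      then have "finite E'" "1 \<notin> E'" using fin[of E'] by auto
      then show ?thesis using 2 by auto
    qed auto
  qed
  moreover have "?A \<inter> insert 1 ` ?B = {}" by auto
  moreover have "finite ?A" "finite ?B"
    using finite_unity_roots[OF p] by (auto intro: finite_subset[of _ "Pow (unity_roots p)"])
  moreover have "inj_on (insert 1) ?B" by (rule inj_onI) (auto simp: insert_ident)
  ultimately have "card {E. E \<subseteq> unity_roots p \<and> card E = Suc s \<and> ?f E = E} = card ?A + card ?B"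
    by (simp add: card_Un_disjoint card_image)
  then show ?thesis using card_power_invariant_aux[OF p k d] by simp
qed

text \<open>
  Multiplication with \<open>c\<close> changes the product of an \<open>n\<close>-element set by \<open>c ^ n\<close>.  As \<open>c \<mapsto> c ^ n\<close> permutes the
  \<open>p\<close>-th roots of unity, each of them is the product of equally many \<open>n\<close>-element sets.
\<close>

lemma card_root_sets:
  assumes p: "prime p" and n: "\<not> p dvd n"
  shows "p * card (root_sets p n) = p choose n"
proof -
  let ?U = "unity_roots p"
  define X where "X \<delta> = {E. E \<subseteq> ?U \<and> card E = n \<and> \<Prod>E = \<delta>}" for \<delta> :: complex
  have finU: "finite ?U" using finite_unity_roots[OF p] .
  have p0: "p > 0" using prime_gt_0_nat[OF p] .
  have nz: "c \<noteq> 0" if "c \<in> ?U" for c using that p0 by (auto simp: power_0_left)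
  have card_le: "card (X (\<delta> * c ^ n)) \<ge> card (X \<delta>)" if c: "c \<in> ?U" for c \<delta>
  proof (rule card_inj_on_le[where f = "\<lambda>E. (*) c ` E"])
    have inj: "inj ((*) c)" using nz[OF c] by (auto intro: injI)
    show "inj_on (\<lambda>E. (*) c ` E) (X \<delta>)" using inj by (auto intro!: inj_onI simp: inj_image_eq_iff)
    show "finite (X (\<delta> * c ^ n))" unfolding X_def using finU by (auto intro: finite_subset[of _ "Pow ?U"])
    show "(\<lambda>E. (*) c ` E) ` X \<delta> \<subseteq> X (\<delta> * c ^ n)"
    proof safe
      fix E assume E: "E \<in> X \<delta>"
      have injE: "inj_on ((*) c) E" using inj inj_on_subset by blast
      have "\<Prod>((*) c ` E) = \<Prod>E * c ^ card E"
        by (simp add: prod.reindex[OF injE] prod.distrib)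
      then have "\<Prod>((*) c ` E) = \<delta> * c ^ n" using E by (simp add: X_def)
      moreover have "(*) c ` E \<subseteq> ?U" using E c by (auto simp: X_def power_mult_distrib)
      moreover have "card ((*) c ` E) = n" using E card_image[OF injE] by (simp add: X_def)
      ultimately show "(*) c ` E \<in> X (\<delta> * c ^ n)" by (simp add: X_def)
    qed
  qed
  have eq: "card (X \<delta>) = card (X 1)" if "\<delta> \<in> ?U" for \<delta>
  proof -
    have "\<delta> \<in> (\<lambda>z. z ^ n) ` ?U" using that power_image_unity_roots[OF p n] by simp
    then obtain c where c: "c \<in> ?U" "\<delta> = c ^ n" by (rule imageE) 
    have "inverse c ^ p = inverse (c ^ p)" by (rule power_inverse)
    then have "inverse c \<in> ?U" using c(1) by simp
    then have "card (X 1) \<ge> card (X \<delta>)"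
      using card_le[of "inverse c" \<delta>] nz[OF c(1)] c(2) power_inverse[of c n] by simp
    then show ?thesis using card_le[OF c(1), of 1] c(2) by simp
  qed
  have "p choose n = card {E. E \<subseteq> ?U \<and> card E = n}"
    using n_subsets[OF finU] card_roots_unity_eq[OF p0] by simp
  also have "{E. E \<subseteq> ?U \<and> card E = n} = (\<Union>\<delta>\<in>?U. X \<delta>)"
  proof -
    have "\<Prod>E \<in> ?U" if "E \<subseteq> ?U" for E
    proof -
      have "(\<Prod>E) ^ p = (\<Prod>z\<in>E. z ^ p)" by (simp add: prod_power_distrib)
      also have "\<dots> = 1" using that by (intro prod.neutral) auto
      finally show ?thesis by simp
    qed
    then show ?thesis by (auto simp: X_def)
  qed
  also have "card \<dots> = (\<Sum>\<delta>\<in>?U. card (X \<delta>))"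
    using finU by (intro card_UN_disjoint) (auto simp: X_def intro: finite_subset[of _ "Pow ?U"])
  also have "\<dots> = (\<Sum>\<delta>\<in>?U. card (X 1))" by (rule sum.cong[OF refl eq])
  also have "\<dots> = p * card (X 1)" using card_roots_unity_eq[OF p0] by simp
  also have "X 1 = root_sets p n" by (simp add: X_def root_sets_def)
  finally show ?thesis by simp
qed

text \<open>
  The product is a \<open>p\<close>-th root of unity that is equal to its \<open>k\<close>-th power.  So the condition on the
  product holds for all sets that are invariant under a nontrivial power map.
\<close>

lemma prod_eq_1_if_invariant:
  assumes p: "prime p" and k: "1 < k" "k < p" and E: "E \<subseteq> unity_roots p" "(\<lambda>z. z ^ k) ` E = E"
  shows "\<Prod>E = 1"
proof -
  have "\<not> p dvd k" using k by (auto dest: dvd_imp_le)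
  then have inj: "inj_on (\<lambda>z. z ^ k) E"
    using inj_on_power_unity_roots[OF p] E(1) by (auto intro: inj_on_subset)
  have "(\<Prod>E) ^ k = (\<Prod>z\<in>E. z ^ k)" by (simp add: prod_power_distrib)
  also have "\<dots> = \<Prod>((\<lambda>z. z ^ k) ` E)" by (simp add: prod.reindex[OF inj])
  finally have 1: "(\<Prod>E) ^ k = (\<Prod>E) ^ 1" unfolding E(2) by simp
  have "(\<Prod>E) ^ p = (\<Prod>z\<in>E. z ^ p)" by (simp add: prod_power_distrib)
  also have "\<dots> = 1" using E(1) by (intro prod.neutral) auto
  finally have 2: "(\<Prod>E) ^ p = 1" .
  show ?thesis
  proof (rule ccontr)
    assume "\<Prod>E \<noteq> 1"
    then have "[k = 1] (mod p)" using root_power_eq_iff[OF p 2] 1 by blast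
    then show False using k cong_less_modulus_unique_nat[of k 1 p] by auto
  qed
qed

lemma totient_2_4_5: "totient 2 = 1" "totient 4 = 2" "totient 5 = 4"
proof -
  show "totient 2 = 1" using totient_prime[of 2] by simp
  show "totient 5 = 4" using totient_prime[of 5] by simp
  show "totient 4 = 2" using totient_prime_power[of 2 2] by simp
qed

text \<open>
  Five elements are a union of orbits of size \<open>d = ord p k\<close>, possibly together with 1, only if \<open>d\<close> divides
  5 or 4.
\<close>

lemma card_invariants_power_action:
  assumes p: "prime p" and k: "k \<in> totatives p" "k \<noteq> 1"
  shows "card (invariants (root_sets p 5) (power_action p 5) k) =
    (if ord p k = 2 then ((p - 1) div 2) choose 2 else 0) + (if ord p k = 4 then (p - 1) div 4 else 0)
     + (if ord p k = 5 then (p - 1) div 5 else 0)"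
proof -
  have k': "1 < k" "k < p" using k p by (auto simp: prime_totatives_iff)
  have "invariants (root_sets p 5) (power_action p 5) k
      = {E. E \<subseteq> unity_roots p \<and> card E = Suc 4 \<and> (\<lambda>z. z ^ k) ` E = E}"
    using prod_eq_1_if_invariant[OF p k'] by (auto simp: invariants_def power_action_def root_sets_def)
  moreover have "ord p k \<noteq> 1" "ord p k \<noteq> 0"
    using k' k ord[of k p] ord_eq_0[of p k] cong_less_modulus_unique_nat[of k 1 p]
    by (auto simp: totatives_def coprime_commute)
  moreover have "ord p k = 2 \<or> ord p k = 4" if "ord p k dvd 4" "ord p k \<noteq> 1"
  proof -
    have "ord p k \<le> 4" "ord p k \<noteq> 3" using that dvd_imp_le[of "ord p k" 4] by (auto intro!: notI)
    then show ?thesis using that \<open>ord p k \<noteq> 0\<close> by linarith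
  qed
  moreover have "ord p k = 5" if "ord p k dvd 5" "ord p k \<noteq> 1"
    using that prime_nat_iff[of 5] by auto
  ultimately show ?thesis
    using card_power_invariant[OF p k(1) refl, of 4] by auto
qed

text \<open>
  In Burnside's sum the unit 1 contributes all sets, and the units of order 2, 4 and 5, of which there
  are \<open>totient d\<close> if \<open>d\<close> divides \<open>p - 1\<close>, contribute the remaining terms.
\<close>

theorem card_power_orbits:
  assumes p: "prime p" "p > 5"
  shows "card (orbits (power_units p) (root_sets p 5) (power_action p 5)) * (p - 1)
    = card (root_sets p 5) + (((p - 1) div 2) choose 2)
     + (if 4 dvd p - 1 then 2 * ((p - 1) div 4) else 0) + (if 5 dvd p - 1 then 4 * ((p - 1) div 5) else 0)"
proof -
  interpret group_action "power_units p" "root_sets p 5" "power_action p 5"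
    by (rule power_action_group_action[OF p(1)])
  have fin: "finite (carrier (power_units p))" by (simp add: power_units_def)
  have fin2: "finite (root_sets p 5)"
    unfolding root_sets_def using finite_unity_roots[OF p(1)] by (auto intro: finite_subset[of _ "Pow (unity_roots p)"])
  have ord: "Coset.order (power_units p) = p - 1"
    using totient_prime[OF p(1)] by (simp add: Coset.order_def power_units_def totient_def)
  let ?i = "\<lambda>k. card (invariants (root_sets p 5) (power_action p 5) k)"
  let ?T = "totatives p"
  have 1: "1 \<in> ?T" using p by (simp add: prime_totatives_iff)
  have i1: "?i 1 = card (root_sets p 5)"
    by (rule arg_cong[of _ _ card]) (auto simp: invariants_def power_action_def)
  have ord1: "ord p 1 = 1" by simp
  have count: "(\<Sum>k\<in>?T - {1}. if ord p k = d then m else 0) = (if d dvd p - 1 then totient d * m else 0)"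
    if "d > 1" for d m
  proof -
    have "(\<Sum>k\<in>?T - {1}. if ord p k = d then m else 0) = (\<Sum>k\<in>{k\<in>?T. ord p k = d}. m)"
      using that by (intro sum.mono_neutral_cong_right) auto
    then show ?thesis
      using prime_card_elements_with_ord_eq_totient[of p d] p prime_gt_1_nat[OF p(1)] by simp
  qed
  have "card (orbits (power_units p) (root_sets p 5) (power_action p 5)) * (p - 1) = (\<Sum>k\<in>?T. ?i k)"
    using burnside[OF fin fin2] ord by (simp add: power_units_def)
  also have "\<dots> = ?i 1 + (\<Sum>k\<in>?T - {1}. ?i k)"
    using 1 by (simp add: sum.remove)
  also have "(\<Sum>k\<in>?T - {1}. ?i k) = (\<Sum>k\<in>?T - {1}. 
     (if ord p k = 2 then ((p - 1) div 2) choose 2 else 0) + (if ord p k = 4 then (p - 1) div 4 else 0)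
     + (if ord p k = 5 then (p - 1) div 5 else 0))"
    by (intro sum.cong) (use card_invariants_power_action[OF p(1)] in auto)
  also have "\<dots> = (((p - 1) div 2) choose 2)
     + (if 4 dvd p - 1 then 2 * ((p - 1) div 4) else 0) + (if 5 dvd p - 1 then 4 * ((p - 1) div 5) else 0)"
  proof -
    have "odd p" using p prime_odd_nat by auto
    then have "2 dvd p - 1" by simp
    then show ?thesis
      unfolding sum.distrib by (simp add: count totient_2_4_5 del: One_nat_def)
  qed
  finally show ?thesis using i1 by simp
qed

section \<open>Cosets of matrices\<close>

abbreviation proj_class :: "complex^'n^'n \<Rightarrow> (complex^'n^'n) set" where
  "proj_class A \<equiv> scalars #>\<^bsub>GL\<^esub> A"

abbreviation mpow :: "complex^'n^'n \<Rightarrow> nat \<Rightarrow> complex^'n^'n" where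
  "mpow A k \<equiv> A [^]\<^bsub>GL\<^esub> k"

definition diag_mat :: "('n \<Rightarrow> complex) \<Rightarrow> complex^'n^'n" where
  "diag_mat e = (\<chi> i j. if i = j then e i else 0)"

lemma mpow_0 [simp]: "mpow A 0 = mat 1"
  and mpow_Suc: "mpow A (Suc k) = mpow A k ** A"
  by (simp_all add: nat_pow_def)

lemma mpow_1 [simp]: "mpow A 1 = A"
  by (simp add: mpow_Suc)

lemma mpow_add: "mpow A (k + l) = mpow A k ** mpow A l"
  by (induction l) (simp_all add: mpow_Suc matrix_mul_assoc)

lemma mpow_commute: "mpow A k ** A = A ** mpow A k"
  using mpow_add[of A 1 k] mpow_add[of A k 1] by simp

lemma mpow_mult: "mpow A (k * l) = mpow (mpow A k) l"
  by (induction l) (simp_all add: mpow_Suc mpow_add add.commute[of k])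

lemma mpow_one [simp]: "mpow (mat 1) k = (mat 1 :: complex^'n^'n)"
  by (induction k) (simp_all add: mpow_Suc)

lemma mpow_vec_add: "mpow A (k + l) *v v = mpow A k *v (mpow A l *v v)"
  by (simp add: mpow_add matrix_vector_mul_assoc)

lemma det_mpow: "det (mpow A k) = det A ^ k"
  by (induction k) (simp_all add: mpow_Suc det_mul)

lemma mpow_intertwine:
  assumes "A ** P = P ** B"
  shows "mpow A k ** P = P ** mpow B k"
proof (induction k)
  case (Suc k)
  have "mpow A (Suc k) ** P = mpow A k ** (A ** P)" by (simp add: mpow_Suc matrix_mul_assoc)
  also have "\<dots> = (mpow A k ** P) ** B" by (simp add: assms matrix_mul_assoc)
  finally show ?case by (simp add: Suc.IH mpow_Suc matrix_mul_assoc)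
qed simp

lemma mat_eq_diag_mat: "mat c = (diag_mat (\<lambda>_. c) :: complex^'n^'n)"
  by (simp add: mat_def diag_mat_def)

lemma diag_mat_mult: "diag_mat e ** diag_mat f = (diag_mat (\<lambda>i. e i * f i) :: complex^'n^'n)"
proof -
  have "(\<Sum>k\<in>UNIV. (if i = k then e i else 0) * (if k = j then f k else 0)) = (if i = j then e i * f i else 0)" for i j :: 'n
  proof -
    have "(\<Sum>k\<in>UNIV. (if i = k then e i else 0) * (if k = j then f k else 0)) = (\<Sum>k\<in>UNIV. if k = i then (if i = j then e i * f i else 0) else 0)"
      by (rule sum.cong) auto
    then show ?thesis by simp
  qed
  then show ?thesis by (simp add: diag_mat_def matrix_matrix_mult_def vec_eq_iff)
qed

lemma diag_mat_vec: "(diag_mat e *v v) $ i = e i * v $ i"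
proof -
  have "(\<Sum>k\<in>UNIV. (if i = k then e i else 0) * v $ k) = (\<Sum>k\<in>UNIV. if k = i then e i * v $ i else 0)"
    by (rule sum.cong) auto
  then show ?thesis by (simp add: diag_mat_def matrix_vector_mult_def)
qed

lemma mult_diag_mat: "(A ** diag_mat e) $ i $ j = A $ i $ j * e j"
proof -
  have "(\<Sum>k\<in>UNIV. A $ i $ k * (if k = j then e k else 0)) = (\<Sum>k\<in>UNIV. if k = j then A $ i $ j * e j else 0)"
    by (rule sum.cong) auto
  then show ?thesis by (simp add: diag_mat_def matrix_matrix_mult_def)
qed

lemma diag_mat_mult_left: "(diag_mat e ** A) $ i $ j = e i * A $ i $ j"
proof -
  have "(\<Sum>k\<in>UNIV. (if i = k then e i else 0) * A $ k $ j) = (\<Sum>k\<in>UNIV. if k = i then e i * A $ i $ j else 0)"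
    by (rule sum.cong) auto
  then show ?thesis by (simp add: diag_mat_def matrix_matrix_mult_def)
qed

lemma mpow_diag_mat: "mpow (diag_mat e) k = diag_mat (\<lambda>i. e i ^ k)"
  by (induction k) (simp_all add: mpow_Suc diag_mat_mult mat_eq_diag_mat mult.commute)

lemma det_diag_mat: "det (diag_mat e :: complex^'n^'n) = (\<Prod>i\<in>UNIV. e i)"
  by (subst det_diagonal) (simp_all add: diag_mat_def)

lemma invertible_diag_mat: "(\<And>i. e i \<noteq> 0) \<Longrightarrow> invertible (diag_mat e :: complex^'n^'n)"
  by (simp add: invertible_det_nz det_diag_mat)

lemma diag_mat_inject: "diag_mat e = diag_mat f \<longleftrightarrow> e = f"
  by (auto simp: diag_mat_def vec_eq_iff fun_eq_iff)

lemma invertible_mpow: "invertible A \<Longrightarrow> invertible (mpow A k)"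
  by (simp add: invertible_det_nz det_mpow)

lemma proj_class_eq: "proj_class A = {mat c ** A | c. c \<noteq> 0}"
  by (auto simp: r_coset_def scalars_def)

lemma proj_class_self: "A \<in> proj_class A"
  unfolding proj_class_eq by (rule CollectI, rule exI[of _ 1]) simp

lemma proj_class_eq_iff: "proj_class A = proj_class B \<longleftrightarrow> (\<exists>c. c \<noteq> 0 \<and> A = mat c ** B)"
proof
  assume "proj_class A = proj_class B"
  then have "A \<in> proj_class B" using proj_class_self by blast
  then show "\<exists>c. c \<noteq> 0 \<and> A = mat c ** B" by (auto simp: proj_class_eq)
next
  assume "\<exists>c. c \<noteq> 0 \<and> A = mat c ** B"
  then obtain c where c: "c \<noteq> 0" "A = mat c ** B" by auto
  have "\<exists>d'. mat d ** B = mat d' ** A \<and> d' \<noteq> 0" if "d \<noteq> 0" for d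
    using that c by (intro exI[of _ "d / c"]) (simp add: matrix_mul_assoc mat_mult_mat)
  moreover have "\<exists>d'. mat d ** A = mat d' ** B \<and> d' \<noteq> 0" if "d \<noteq> 0" for d
    using that c by (intro exI[of _ "d * c"]) (simp add: matrix_mul_assoc mat_mult_mat)
  ultimately show "proj_class A = proj_class B" unfolding proj_class_eq by blast
qed

lemma proj_class_hom: "group_hom GL (PGL :: (complex^'n^'n) set monoid) proj_class"
  unfolding group_hom_def group_hom_axioms_def PGL_def
  using group_GL normal_scalars normal.factorgroup_is_group normal.r_coset_hom_Mod by blast

lemma carrier_PGL: "carrier PGL = proj_class ` {A. invertible A}"
  by (auto simp: PGL_def FactGroup_def RCOSETS_def)

lemma one_PGL: "\<one>\<^bsub>PGL\<^esub> = proj_class (mat 1)"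
  using group_hom.hom_one[OF proj_class_hom, symmetric] by simp

lemma proj_class_mult: "invertible A \<Longrightarrow> invertible B \<Longrightarrow> proj_class A \<otimes>\<^bsub>PGL\<^esub> proj_class B = proj_class (A ** B)"
  using group_hom.hom_mult[OF proj_class_hom, of A B] by simp

lemma proj_class_pow: "invertible A \<Longrightarrow> proj_class A [^]\<^bsub>PGL\<^esub> (k::nat) = proj_class (mpow A k)"
  using group_hom.hom_nat_pow[OF proj_class_hom, of A k] by simp

lemma proj_class_conj:
  assumes "invertible P" "invertible A" "invertible B" "A ** P = P ** B"
  shows "proj_class P \<otimes>\<^bsub>PGL\<^esub> proj_class B \<otimes>\<^bsub>PGL\<^esub> inv\<^bsub>PGL\<^esub> proj_class P = proj_class A"
proof -
  interpret group "PGL :: (complex^'a^'a) set monoid" by (rule group_PGL)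
  have c: "proj_class P \<in> carrier PGL" "proj_class A \<in> carrier PGL" "proj_class B \<in> carrier PGL"
    using assms by (auto simp: carrier_PGL)
  have "proj_class P \<otimes>\<^bsub>PGL\<^esub> proj_class B = proj_class A \<otimes>\<^bsub>PGL\<^esub> proj_class P"
    using assms by (simp add: proj_class_mult)
  then show ?thesis using c by (simp add: m_assoc)
qed

section \<open>Cyclic subgroups of prime order\<close>

lemma (in group) prime_order_generate:
  assumes "prime p" "x \<in> carrier G" "x [^] p = \<one>" "x \<noteq> \<one>"
  shows "generate G {x} = {x [^] k | k::nat. True}" "card (generate G {x}) = p" "ord x = p"
proof -
  have "ord x dvd p" using assms(2,3) pow_eq_id[of x p] by simp
  moreover have "ord x \<noteq> 1" using assms(2,4) ord_eq_1 by blast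
  ultimately show ord: "ord x = p" using assms(1) by (auto simp: prime_nat_iff)
  then have "ord x \<noteq> 0" using assms(1) by (auto simp: prime_gt_0_nat)
  then show "generate G {x} = {x [^] k | k::nat. True}" using generate_pow_nat[OF assms(2)] by simp
  show "card (generate G {x}) = p" using generate_pow_card[OF assms(2)] ord by simp
qed

lemma (in group) cyclic_subgroup_generate:
  assumes "x \<in> carrier G"
  shows "cyclic_group (subgroup_generated G (generate G {x}))"
proof -
  have sub: "subgroup (generate G {x}) G" using assms by (intro generate_is_subgroup) simp
  have "subgroup_generated G (generate G {x}) = subgroup_generated G {x}"
    using subgroup.carrier_subgroup_generated_subgroup[OF sub] assms
    by (simp add: subgroup_generated_def)
  then show ?thesis by (simp add: cyclic_group_generated)
qed

lemma (in group) cyclic_subgroupE: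
  assumes "subgroup H G" "cyclic_group (subgroup_generated G H)" "card H = p" "prime p"
  obtains x where "x \<in> carrier G" "x [^] p = \<one>" "x \<noteq> \<one>" "H = generate G {x}"
proof -
  have car: "carrier (subgroup_generated G H) = H"
    using subgroup.carrier_subgroup_generated_subgroup[OF assms(1)] .
  interpret S: group "subgroup_generated G H" by simp
  obtain x where x: "x \<in> H" "H = range (\<lambda>n::int. x [^]\<^bsub>subgroup_generated G H\<^esub> n)"
    using assms(2) unfolding S.cyclic_group car by auto
  then have xG: "x \<in> carrier G" using assms(1) subgroup.mem_carrier by metis
  have "H = range (\<lambda>n::int. x [^] n)"
    using x int_pow_subgroup_generated[of x H] car by simp
  then have H: "H = generate G {x}" using generate_pow[OF xG] by auto
  then have "ord x = p" using generate_pow_card[OF xG] assms(3) by simp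
  then have "x [^] p = \<one>" "x \<noteq> \<one>" 
    using pow_ord_eq_1[OF xG] assms(4) by (auto simp: ord_eq_1[OF xG, symmetric])
  then show ?thesis using that xG H by blast
qed

text \<open>
  Conjugation is a homomorphism and maps the generator of a cyclic group to a generator.
\<close>

lemma (in group) conj_generate:
  assumes g: "g \<in> carrier G" and x: "x \<in> carrier G"
  shows "g <# generate G {x} #> inv g = generate G {g \<otimes> x \<otimes> inv g}"
proof -
  let ?c = "\<lambda>h. g \<otimes> h \<otimes> inv g"
  have "group_hom G G ?c"
    unfolding group_hom_def group_hom_axioms_def hom_def
    using g by (auto simp: m_assoc inv_solve_left)
  then have "?c ` generate G {x} = generate G {?c x}"
    using group_hom.generate_img[of G G ?c "{x}"] x by simp
  moreover have "g <# generate G {x} #> inv g = ?c ` generate G {x}"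
    by (auto simp: l_coset_def r_coset_def)
  ultimately show ?thesis by simp
qed

section \<open>Spectral decomposition of matrices of prime order\<close>

lemma mv_sum: "A *v (\<Sum>k\<in>S. f k) = (\<Sum>k\<in>S. A *v f k)" for A :: "complex^'n^'m"
  by (induction S rule: infinite_finite_induct) (simp_all add: matrix_vector_right_distrib)

text \<open>
  Eigenvectors with different eigenvalues are independent.  As the eigenvalues are \<open>p\<close>-th roots of unity,
  the terms of a linear relation are separated by a Fourier sum over its images under the powers
  of \<open>A\<close>.
\<close>

lemma eigencolumns_invertible:
  fixes A P :: "complex^'n^'n"
  assumes AP: "A ** P = P ** diag_mat e" and e: "inj e" "\<And>i. e i ^ p = 1" "p > 0"
    and col: "\<And>j. \<exists>i. P $ i $ j \<noteq> 0"
  shows "invertible P"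
  unfolding invertible_left_inverse matrix_left_invertible_ker
proof (intro allI impI)
  fix x :: "complex^'n" assume x: "P *v x = 0"
  have nz: "e i \<noteq> 0" for i using e(2)[of i] e(3) by (auto simp: power_0_left)
  have 0: "(\<Sum>i\<in>UNIV. P $ r $ i * (e i ^ k * x $ i)) = 0" for r k
  proof -
    have "P *v (mpow (diag_mat e) k *v x) = mpow A k *v (P *v x)"
      by (simp add: matrix_vector_mul_assoc mpow_intertwine[OF AP])
    then have "(P *v (mpow (diag_mat e) k *v x)) $ r = 0" by (simp add: x)
    then show ?thesis by (simp add: matrix_vector_mult_def[of P] mpow_diag_mat diag_mat_vec)
  qed
  have "x $ j = 0" for j
  proof -
    obtain r where r: "P $ r $ j \<noteq> 0" using col by blast
    have "(\<Sum>k<p. inverse (e j) ^ k * (\<Sum>i\<in>UNIV. P $ r $ i * (e i ^ k * x $ i)))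
        = (\<Sum>i\<in>UNIV. P $ r $ i * x $ i * (\<Sum>k<p. (e i / e j) ^ k))"
      unfolding sum_distrib_left
      by (subst sum.swap) (simp add: power_divide divide_inverse power_mult_distrib power_inverse mult_ac)
    also have "\<dots> = (\<Sum>i\<in>UNIV. if i = j then P $ r $ j * x $ j * of_nat p else 0)"
    proof (rule sum.cong)
      fix i
      have "(e i / e j) ^ p = 1" by (simp add: power_divide e(2))
      then have "(\<Sum>k<p. (e i / e j) ^ k) = (if e i / e j = 1 then of_nat p else 0)"
        by (rule sum_powers_root)
      then show "P $ r $ i * x $ i * (\<Sum>k<p. (e i / e j) ^ k) = (if i = j then P $ r $ j * x $ j * of_nat p else 0)"
        using nz e(1) by (auto dest: injD)
    qed simp
    also have "\<dots> = P $ r $ j * x $ j * of_nat p" by simp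
    finally show ?thesis using r e(3) by (simp add: 0)
  qed
  then show "x = 0" by (simp add: vec_eq_iff)
qed

text \<open>
  The Fourier sums \<open>u w = \<Sum>k<p. w\<^sup>-\<^sup>k A\<^sup>k v\<close> are zero or eigenvectors with eigenvalue \<open>w\<close>, and Fourier
  inversion recovers the vectors \<open>A\<^sup>k v\<close> from them.  So the nonzero ones among them span the whole space, and
  there are enough of them for a basis.
\<close>

lemma cyclic_vector_diagonalization:
  fixes A :: "complex^'n^'n"
  assumes p: "prime p" and Ap: "mpow A p = mat 1"
    and span: "vec.span ((\<lambda>k. mpow A k *v v) ` {..<p}) = UNIV"
  obtains P :: "complex^'n^'n" and e where "invertible P" "inj e" "\<And>i. e i ^ p = 1" "A ** P = P ** diag_mat e"
proof -
  let ?U = "unity_roots p"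
  have p0: "p > 0" using prime_gt_0_nat[OF p] .
  have fin: "finite ?U" using finite_unity_roots[OF p] .
  have nz: "w \<noteq> 0" if "w \<in> ?U" for w using that p0 by (auto simp: power_0_left)
  define u where "u w = (\<Sum>k<p. inverse w ^ k *s (mpow A k *v v))" for w
  have Au: "A *v u w = w *s u w" if w: "w \<in> ?U" for w
  proof -
    let ?f = "\<lambda>k. inverse w ^ k *s (mpow A k *v v)"
    have "inverse w ^ p = 1" using w power_inverse[of w p] by simp
    then have "?f p = ?f 0" by (simp add: Ap)
    \<comment> \<open>The summand has period \<open>p\<close> in \<open>k\<close>, so a shift of the index does not change the sum.\<close>
    then have shift: "(\<Sum>k<p. ?f (Suc k)) = (\<Sum>k<p. ?f k)"
      using sum.lessThan_Suc_shift[of ?f p] sum.lessThan_Suc[of ?f p] by simp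
    have "A *v u w = (\<Sum>k<p. A *v ?f k)" unfolding u_def by (rule mv_sum)
    also have "\<dots> = (\<Sum>k<p. w *s ?f (Suc k))"
      by (rule sum.cong)
         (use nz[OF w] in \<open>simp_all add: vector_scalar_commute matrix_vector_mul_assoc mpow_Suc mpow_commute\<close>)
    also have "\<dots> = w *s u w" unfolding vec.scale_sum_right[symmetric] shift u_def ..
    finally show ?thesis .
  qed
  have recon: "(\<Sum>w\<in>?U. w ^ j *s u w) = of_nat p *s (mpow A j *v v)" if j: "j < p" for j
  proof -
    have coef: "(\<Sum>w\<in>?U. w ^ j * inverse w ^ k) = (if k = j then of_nat p else 0)" if k: "k < p" for k
    proof -
      have "(\<Sum>w\<in>?U. w ^ j * inverse w ^ k) = (\<Sum>w\<in>?U. w ^ (j + (p - k)))"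
      proof (rule sum.cong)
        fix w assume w: "w \<in> ?U"
        have "w ^ (p - k) * w ^ k = 1" using w k by (simp flip: power_add)
        then have "w ^ (p - k) = inverse w ^ k"
          using nz[OF w] by (simp add: field_simps power_inverse)
        then show "w ^ j * inverse w ^ k = w ^ (j + (p - k))" by (simp add: power_add)
      qed simp
      also have "\<dots> = (if p dvd j + (p - k) then of_nat p else 0)"
        by (rule sum_powers_over_unity_roots[OF p])
      also have "p dvd j + (p - k) \<longleftrightarrow> k = j"
      proof
        assume "p dvd j + (p - k)"
        then obtain m where m: "j + (p - k) = p * m" by (auto elim: dvdE)
        have "0 < p * m" "p * m < p * 2" using m j k by linarith+
        then have "m = 1" by auto
        then show "k = j" using m k by simp
      qed (use k in simp)
      finally show ?thesis .
    qed
    have "(\<Sum>w\<in>?U. w ^ j *s u w) = (\<Sum>k<p. (\<Sum>w\<in>?U. w ^ j * inverse w ^ k) *s (mpow A k *v v))"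
      unfolding u_def vec.scale_sum_right vec.scale_sum_left vec.scale_scale by (rule sum.swap)
    also have "\<dots> = (\<Sum>k<p. if k = j then of_nat p *s (mpow A j *v v) else 0)"
      by (rule sum.cong) (auto simp: coef)
    finally show ?thesis using j by simp
  qed
  define W where "W = {w \<in> ?U. u w \<noteq> 0}"
  have finW: "finite W" using fin by (simp add: W_def)
  have "mpow A j *v v \<in> vec.span (u ` W)" if "j < p" for j
  proof -
    have "u w \<in> vec.span (u ` W)" if "w \<in> ?U" for w
    proof (cases "u w = 0")
      case True then show ?thesis by (simp add: vec.span_zero)
    next
      case False then show ?thesis using that by (intro vec.span_base) (auto simp: W_def)
    qed
    then have "inverse (of_nat p) *s (\<Sum>w\<in>?U. w ^ j *s u w) \<in> vec.span (u ` W)"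
      by (intro vec.span_scale vec.span_sum) auto
    then show ?thesis using recon[OF that] p0 by (simp add: vec.scale_scale)
  qed
  then have "UNIV \<subseteq> vec.span (u ` W)"
    using vec.span_minimal[of "(\<lambda>k. mpow A k *v v) ` {..<p}" "vec.span (u ` W)"] span by auto
  then have "CARD('n) \<le> card (u ` W)"
    using vec.dim_le_card[of UNIV "u ` W"] finW unfolding vec_dim_card by simp
  also have "\<dots> \<le> card W" using finW by (rule card_image_le)
  finally obtain E where E: "E \<subseteq> W" "card E = CARD('n)" "finite E"
    by (rule obtain_subset_with_card_n)
  then obtain e where e: "bij_betw e (UNIV :: 'n set) E"
    using finite_same_card_bij[of "UNIV :: 'n set" E] by auto
  then have eW: "e i \<in> W" for i using E(1) by (auto simp: bij_betw_def)
  have inj: "inj e" using e by (simp add: bij_betw_def)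
  have ep: "e i ^ p = 1" for i using eW[of i] by (simp add: W_def)
  define P where "P = (\<chi> i j. u (e j) $ i)"
  have AP: "A ** P = P ** diag_mat e"
  proof -
    have "(A ** P) $ i $ j = (A *v u (e j)) $ i" for i j
      by (simp add: P_def matrix_matrix_mult_def matrix_vector_mult_def)
    also have "\<dots> i j = (P ** diag_mat e) $ i $ j" for i j
      using Au[of "e j"] eW[of j] by (simp add: W_def mult_diag_mat P_def)
    finally show ?thesis by (simp add: vec_eq_iff)
  qed
  have "\<exists>i. P $ i $ j \<noteq> 0" for j
    using eW[of j] by (simp add: W_def P_def vec_eq_iff)
  from eigencolumns_invertible[OF AP inj ep p0 this] show ?thesis
    using that inj ep AP by blast
qed


section \<open>Invariant point sets in general position\<close>

lemma proj_pointE: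
  fixes L :: "(complex^'n) set"
  assumes "L \<in> proj_points"
  obtains v where "v \<noteq> 0" "L = vec.span {v}"
proof -
  have L: "vec.subspace L" "vec.dim L = 1" using assms by (auto simp: proj_points_def)
  obtain B where B: "B \<subseteq> L" "vec.independent B" "L \<subseteq> vec.span B" "card B = vec.dim L"
    by (rule vec.basis_exists)
  then obtain v where v: "B = {v}" using L(2) by (auto simp: card_1_singleton_iff)
  have "v \<noteq> 0" using B(2) v vec.dependent_zero[of B] by auto
  moreover have "L = vec.span {v}" using B v vec.span_minimal[of B L] L(1) by auto
  ultimately show ?thesis using that by blast
qed

lemma span_singleton_proj_point:
  fixes v :: "complex^'n"
  assumes "v \<noteq> 0"
  shows "vec.span {v} \<in> proj_points"
proof -
  have "vec.independent {v}" using assms by simp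
  then have "vec.dim {v} = 1" using vec.dim_eq_card_independent[of "{v}"] by simp
  then show ?thesis by (simp add: proj_points_def vec.dim_span)
qed

lemma mpow_fixes_subset:
  fixes A :: "complex^'n^'n"
  assumes "(*v) A ` L = L"
  shows "(*v) (mpow A k) ` L = L"
proof (induction k)
  case (Suc k)
  have "(*v) (mpow A (Suc k)) ` L = (*v) (mpow A k) ` (*v) A ` L"
    by (simp add: mpow_Suc image_image matrix_vector_mul_assoc)
  then show ?case using assms Suc.IH by simp
qed simp

text \<open>
  The exponents \<open>m\<close> for which \<open>A\<^sup>m\<close> fixes \<open>L\<close> form a subgroup modulo \<open>p\<close>, which is trivial as it does not
  contain 1.
\<close>

lemma prime_order_orbit_injective:
  fixes A :: "complex^'n^'n"
  assumes p: "prime p" and A: "invertible A" and Ap: "mpow A p = mat 1" and L: "(*v) A ` L \<noteq> L"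
  shows "inj_on (\<lambda>k. (*v) (mpow A k) ` L) {..<p}"
proof -
  have neq: "(*v) (mpow A k) ` L \<noteq> (*v) (mpow A l) ` L" if kl: "k < l" "l < p" for k l
  proof
    assume eq: "(*v) (mpow A k) ` L = (*v) (mpow A l) ` L"
    define m where "m = l - k"
    have "(*v) (mpow A l) ` L = (*v) (mpow A k) ` (*v) (mpow A m) ` L"
      using kl by (simp add: m_def image_image flip: mpow_vec_add)
    moreover have "inj ((*v) (mpow A k))"
      using invertible_mpow[OF A, of k] by (simp add: invertible_eq_bij bij_def)
    ultimately have fix_m: "(*v) (mpow A m) ` L = L" using eq by (simp add: inj_image_eq_iff)
    have "\<not> p dvd m" using kl by (auto simp: m_def dest: dvd_imp_le)
    then have "coprime m p" using p prime_imp_coprime coprime_commute by blast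
    moreover have "m \<noteq> 0" using kl by (simp add: m_def)
    ultimately obtain x y where "m * x = p * y + 1"
      using bezout_nat[of m p] by (auto simp: coprime_iff_gcd_eq_1)
    moreover have "mpow A (p * y + 1) = A" by (simp add: mpow_add mpow_mult Ap del: One_nat_def)
    ultimately have "mpow A (m * x) = A" by simp
    moreover have "(*v) (mpow A (m * x)) ` L = L" unfolding mpow_mult by (rule mpow_fixes_subset[OF fix_m])
    ultimately show False using L by simp
  qed
  show ?thesis
    by (rule inj_onI) (metis lessThan_iff linorder_neqE_nat neq)
qed

lemma general_positionD:
  fixes T :: "(complex^'n) set set"
  assumes "general_position T" "S \<subseteq> T" "finite S" "card S \<le> CARD('n)"
  shows "vec.dim (\<Union>S) = card S"
  using assms by (auto simp: general_position_def vec.dim_span)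

text \<open>
  The orbit of \<open>L\<close> has \<open>p\<close> points, and already the first \<open>CARD('n)\<close> of them span the space because they are in
  general position.
\<close>

lemma moved_point_cyclic_vector:
  fixes A :: "complex^'n^'n"
  assumes p: "prime p" "CARD('n) \<le> p" and A: "invertible A" and Ap: "mpow A p = mat 1"
    and T: "T \<subseteq> proj_points" "general_position T" "\<And>L. L \<in> T \<Longrightarrow> (*v) A ` L \<in> T"
    and L: "L \<in> T" "(*v) A ` L \<noteq> L"
  obtains v where "vec.span ((\<lambda>k. mpow A k *v v) ` {..<p}) = UNIV"
proof -
  obtain v where v: "L = vec.span {v}" using proj_pointE L(1) T(1) by blast
  define M where "M k = (*v) (mpow A k) ` L" for k
  have MT: "M k \<in> T" for k
  proof (induction k)
    case (Suc k)
    have "M (Suc k) = (*v) A ` M k"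
      by (simp add: M_def mpow_Suc mpow_commute image_image matrix_vector_mul_assoc)
    then show ?case using T(3)[OF Suc.IH] by simp
  qed (simp add: M_def L(1))
  have inj: "inj_on M {..<CARD('n)}"
    using inj_on_subset[OF prime_order_orbit_injective[OF p(1) A Ap L(2)], of "{..<CARD('n)}"] p(2)
    by (auto simp: M_def [abs_def])
  let ?S = "M ` {..<CARD('n)}" and ?V = "(\<lambda>k. mpow A k *v v) ` {..<p}"
  have "vec.dim (\<Union>?S) = card ?S"
    using MT by (intro general_positionD[OF T(2)]) (auto simp: card_image[OF inj])
  then have dim: "vec.dim (\<Union>?S) = CARD('n)" by (simp add: card_image[OF inj])
  have "\<Union>?S \<subseteq> vec.span ?V"
  proof
    fix w assume "w \<in> \<Union>?S"
    then obtain k where k: "k < CARD('n)" "w \<in> M k" by auto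
    then obtain c where "w = c *s (mpow A k *v v)"
      unfolding M_def v vec.span_singleton vector_scalar_commute image_image by blast
    moreover have "mpow A k *v v \<in> vec.span ?V" using k(1) p(2) by (intro vec.span_base) auto
    ultimately show "w \<in> vec.span ?V" by (simp add: vec.span_scale)
  qed
  then have "CARD('n) \<le> vec.dim (vec.span ?V)"
    using vec.dim_subset[of "\<Union>?S" "vec.span ?V"] dim by simp
  moreover have "vec.dim (vec.span ?V) \<le> CARD('n)"
    using vec.dim_subset[of "vec.span ?V" UNIV] unfolding vec_dim_card by simp
  ultimately have "vec.dim ?V = vec.dim (UNIV :: (complex^'n) set)"
    unfolding vec_dim_card vec.dim_span by simp
  then have "vec.span ?V = UNIV" using vec.dim_eq_full[of ?V] vec.dim_UNIV by (metis vec.dimension_def)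
  then show ?thesis using that by blast
qed

text \<open>
  Take vectors on \<open>CARD('n) + 1\<close> of the points and express the last as a combination of the others, which
  form a basis.  By general position no coefficient vanishes, and comparing coefficients in its image
  under \<open>A\<close> shows that all eigenvalues agree.
\<close>

lemma fixed_points_scalar:
  fixes A :: "complex^'n^'n"
  assumes T: "T \<subseteq> proj_points" "finite T" "card T \<ge> CARD('n) + 1" "general_position T"
    and fixed: "\<And>L. L \<in> T \<Longrightarrow> (*v) A ` L = L"
  obtains c where "A = mat c"
proof -
  have "\<exists>v l. v \<noteq> 0 \<and> L = vec.span {v} \<and> A *v v = l *s v" if "L \<in> T" for L
  proof -
    have "L \<in> proj_points" using that T(1) by auto
    then obtain v where v: "v \<noteq> 0" "L = vec.span {v}" by (rule proj_pointE)
    have "v \<in> L" unfolding v(2) by (simp add: vec.span_base)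
    then have "A *v v \<in> L" using fixed[OF that] by blast
    then obtain l where "A *v v = l *s v" unfolding v(2) vec.span_singleton by auto
    with v show ?thesis by blast
  qed
  then obtain v l where vl: "\<And>L. L \<in> T \<Longrightarrow> v L \<noteq> 0" "\<And>L. L \<in> T \<Longrightarrow> L = vec.span {v L}"
    "\<And>L. L \<in> T \<Longrightarrow> A *v v L = l L *s v L" by metis
  have "T \<noteq> {}" using T(3) by auto
  then obtain L0 where L0: "L0 \<in> T" by auto
  have "CARD('n) \<le> card (T - {L0})" using T(2,3) L0 by simp
  then obtain S where S: "S \<subseteq> T - {L0}" "card S = CARD('n)" "finite S"
    by (rule obtain_subset_with_card_n)
  have ST: "S \<subseteq> T" using S(1) by auto
  have inj: "inj_on v T" by (rule inj_onI) (metis vl(2))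
  have span_Union: "vec.span (\<Union>R) = vec.span (v ` R)" if "R \<subseteq> T" for R
  proof
    have "\<Union>R \<subseteq> vec.span (v ` R)"
    proof
      fix x assume "x \<in> \<Union>R"
      then obtain L where L: "L \<in> R" "x \<in> L" by auto
      then have "x \<in> vec.span {v L}" using vl(2) that by auto
      moreover have "vec.span {v L} \<subseteq> vec.span (v ` R)" using L(1) by (intro vec.span_mono) auto
      ultimately show "x \<in> vec.span (v ` R)" by auto
    qed
    then show "vec.span (\<Union>R) \<subseteq> vec.span (v ` R)" by (simp add: vec.span_minimal)
    have "v L \<in> L" if "L \<in> T" for L using vl(2)[OF that] vec.span_base[of "v L" "{v L}"] by auto
    then have "v ` R \<subseteq> \<Union>R" using that by auto
    then show "vec.span (v ` R) \<subseteq> vec.span (\<Union>R)" by (rule vec.span_mono)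
  qed
  have dim: "vec.dim (v ` R) = card R" if "R \<subseteq> T" "finite R" "card R \<le> CARD('n)" for R
    using general_positionD[OF T(4) that] span_Union[OF that(1)] vec.dim_span by metis
  have dimS: "vec.dim (v ` S) = CARD('n)" using dim[OF ST] S by simp
  have injS: "inj_on v S" using inj ST inj_on_subset by blast
  have spanS: "vec.span (v ` S) = UNIV"
    using vec.dim_eq_full[of "v ` S"] vec.dim_UNIV dimS vec_dim_card by (metis vec.dimension_def)
  have indep: "vec.independent (v ` S)"
    by (rule vec.card_le_dim_spanning[of _ UNIV])
       (use spanS S(2,3) card_image[OF injS] in \<open>simp_all only: vec_dim_card finite_imageI subset_UNIV order_refl\<close>)
  have "v L0 \<in> vec.span (v ` S)" using spanS by simp
  then obtain c' where "v L0 = (\<Sum>w\<in>v ` S. c' w *s w)"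
    using S(3) by (auto simp: vec.span_finite)
  then have c: "v L0 = (\<Sum>L\<in>S. c' (v L) *s v L)" by (simp add: sum.reindex[OF injS])
  have c0: "c' (v M) \<noteq> 0" if M: "M \<in> S" for M
  proof
    \<comment> \<open>The last vector would lie in the span of \<open>CARD('n) - 1\<close> of the others.\<close>
    assume c'0: "c' (v M) = 0"
    let ?R = "S - {M}"
    have "v L0 = (\<Sum>L\<in>?R. c' (v L) *s v L)" unfolding c using S(3) M c'0 by (simp add: sum.remove)
    also have "\<dots> \<in> vec.span (v ` ?R)" by (intro vec.span_sum vec.span_scale vec.span_base) auto
    finally have *: "vec.dim (v ` insert L0 ?R) = vec.dim (v ` ?R)" by (simp add: vec.dim_insert)
    have R: "finite ?R" "?R \<subseteq> T" "insert L0 ?R \<subseteq> T" "L0 \<notin> ?R" using S(1,3) L0 by auto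
    have cardR: "Suc (card ?R) = CARD('n)" using card_Suc_Diff1[OF S(3) M] S(2) by simp
    have "card (insert L0 ?R) = Suc (card ?R)" using R by (intro card_insert_disjoint)
    then show False using dim[OF R(2,1)] dim[OF R(3)] R(1) cardR * by simp
  qed
  have "(\<Sum>L\<in>S. (c' (v L) * (l L - l L0)) *s v L) = A *v v L0 - l L0 *s v L0"
    unfolding c mv_sum vec.scale_sum_right sum_subtractf[symmetric]
    by (rule sum.cong) (use ST vl(3) in \<open>auto simp: vector_scalar_commute vec.scale_left_diff_distrib vec.scale_scale algebra_simps\<close>)
  also have "\<dots> = 0" using vl(3)[OF L0] by simp
  finally have sum0: "(\<Sum>w\<in>v ` S. (c' w * (l (inv_into S v w) - l L0)) *s w) = 0"
    by (simp add: sum.reindex[OF injS] inv_into_f_f[OF injS])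
  have "\<forall>w\<in>v ` S. f w = 0" if "(\<Sum>w\<in>v ` S. f w *s w) = 0" for f
    using indep that unfolding vec.dependent_finite[OF finite_imageI[OF S(3)]] by blast
  from this[OF sum0] have "\<forall>w\<in>v ` S. c' w * (l (inv_into S v w) - l L0) = 0" .
  then have eig: "l L = l L0" if "L \<in> S" for L
    using c0[OF that] that inv_into_f_f[OF injS that] by force
  have "A *v x = l L0 *s x" for x
  proof -
    have "x \<in> vec.span (v ` S)" using spanS by simp
    then show ?thesis
    proof (induction rule: vec.span_induct)
      case base
      show ?case
        unfolding vec.subspace_def
        by (auto simp: matrix_vector_right_distrib vec.scale_right_distrib vector_scalar_commute vec.scale_scale mult.commute)
    next
      case (step x)
      then show ?case using vl(3) eig ST by auto
    qed
  qed
  then have "A = mat (l L0)" by (intro matrix_eq[THEN iffD2] allI) (simp add: mat_mult_vec)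
  then show ?thesis using that by blast
qed

section \<open>Diagonal cyclic groups\<close>

definition diag_group :: "('n \<Rightarrow> complex) \<Rightarrow> (complex^'n^'n) set set" where
  "diag_group e = generate PGL {proj_class (diag_mat e)}"

lemma root_nonzero: "e ^ p = 1 \<Longrightarrow> prime p \<Longrightarrow> e \<noteq> (0::complex)"
  using prime_gt_0_nat[of p] by (auto simp: power_0_left)

lemma proj_class_diag_mat_props:
  fixes e :: "'n::finite \<Rightarrow> complex"
  assumes p: "prime p" and e: "inj e" "\<And>i. e i ^ p = 1" and n: "CARD('n) \<ge> 2"
  shows "invertible (diag_mat e)" "proj_class (diag_mat e) \<in> carrier PGL" "proj_class (diag_mat e) [^]\<^bsub>PGL\<^esub> p = \<one>\<^bsub>PGL\<^esub>"
    "proj_class (diag_mat e) \<noteq> \<one>\<^bsub>PGL\<^esub>"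
proof -
  show inv: "invertible (diag_mat e)" using root_nonzero[OF e(2) p] by (rule invertible_diag_mat)
  then show "proj_class (diag_mat e) \<in> carrier PGL" by (auto simp: carrier_PGL)
  show "proj_class (diag_mat e) [^]\<^bsub>PGL\<^esub> p = \<one>\<^bsub>PGL\<^esub>"
    using inv by (simp add: proj_class_pow mpow_diag_mat e(2) one_PGL mat_eq_diag_mat)
  show "proj_class (diag_mat e) \<noteq> \<one>\<^bsub>PGL\<^esub>"
  proof
    assume "proj_class (diag_mat e) = \<one>\<^bsub>PGL\<^esub>"
    then obtain c where "diag_mat e = mat c ** mat 1" unfolding one_PGL proj_class_eq_iff by blast
    then have "diag_mat e = mat c" by simp
    then have "diag_mat e = diag_mat (\<lambda>_. c)" by (simp only: mat_eq_diag_mat)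
    then have c: "e i = c" for i by (simp add: diag_mat_inject)
    obtain i j :: 'n where "i \<noteq> j" using n by (metis (full_types) One_nat_def card_1_singleton_iff UNIV_eq_I empty_iff finite_UNIV card_le_Suc0_iff_eq numeral_2_eq_2 Suc_n_not_le_n insert_iff)
    then show False using e(1) c by (metis injD)
  qed
qed

lemma diag_group_facts:
  fixes e :: "'n::finite \<Rightarrow> complex"
  assumes p: "prime p" and e: "inj e" "\<And>i. e i ^ p = 1" and n: "CARD('n) \<ge> 2"
  shows "diag_group e = {proj_class (diag_mat (\<lambda>i. e i ^ k)) | k. True}" "card (diag_group e) = p"
    "subgroup (diag_group e) PGL" "cyclic_group (subgroup_generated PGL (diag_group e))"
proof -
  interpret group "PGL :: (complex^'n^'n) set monoid" by (rule group_PGL)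
  note x = proj_class_diag_mat_props[OF assms]
  show "diag_group e = {proj_class (diag_mat (\<lambda>i. e i ^ k)) | k. True}"
    using prime_order_generate(1)[OF p x(2-4)] by (simp add: diag_group_def proj_class_pow x(1) mpow_diag_mat)
  show "card (diag_group e) = p"
    using prime_order_generate(2)[OF p x(2-4)] by (simp add: diag_group_def)
  show "subgroup (diag_group e) PGL"
    unfolding diag_group_def using x(2) by (intro generate_is_subgroup) simp
  show "cyclic_group (subgroup_generated PGL (diag_group e))"
    unfolding diag_group_def using x(2) by (rule cyclic_subgroup_generate)
qed

text \<open>
  The vectors \<open>w k\<close> form the orbit of \<open>(1, \<dots>, 1)\<close> under the diagonal matrix with entries \<open>e i\<close>.  The index set
  \<open>K\<close> is enlarged to \<open>CARD('n)\<close> elements, where the determinant of Chebotarev's theorem decides about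
  independence.
\<close>

lemma fourier_orbit_general_position:
  fixes e :: "'n::{finite,wellorder} \<Rightarrow> complex"
  assumes p: "prime p" and e: "inj e" "\<And>i. e i ^ p = 1" and n: "CARD('n::{finite,wellorder}) \<le> p"
    and w: "w = (\<lambda>k. \<chi> i. e i ^ k)"
    and K: "K \<subseteq> {..<p}" "card K \<le> CARD('n)"
  shows "vec.independent (w ` K)" "inj_on w K"
proof -
  obtain K' where K': "K \<subseteq> K'" "K' \<subseteq> {..<p}" "card K' = CARD('n)"
  proof -
    have "finite K" using K(1) finite_subset by blast
    then have "CARD('n) - card K \<le> card ({..<p} - K)" using K n by (simp add: card_Diff_subset)
    then obtain R where R: "R \<subseteq> {..<p} - K" "card R = CARD('n) - card K" "finite R"
      by (rule obtain_subset_with_card_n)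
    then have "card (K \<union> R) = CARD('n)" using K \<open>finite K\<close> by (subst card_Un_disjoint) auto
    then show ?thesis using that[of "K \<union> R"] R K(1) by auto
  qed
  then have "finite K'" using finite_subset by blast
  then obtain b where b: "bij_betw b (UNIV :: 'n set) K'"
    using finite_same_card_bij[of "UNIV :: 'n set" K'] K'(3) by auto
  define A where "A = (\<chi> i j. e i ^ b j)"
  have "inj b" "\<And>i. b i < p" using b K'(2) by (auto simp: bij_betw_def)
  then have det: "det A \<noteq> 0" unfolding A_def using chebotarev[OF p e] by blast
  have wb: "row j (transpose A) = w (b j)" for j by (simp add: A_def row_def transpose_def w)
  have rows: "rows (transpose A) = w ` K'"
    unfolding rows_def wb using b by (auto simp: bij_betw_def)
  have "vec.independent (rows (transpose A))"
    using det_dependent_rows[of "transpose A"] det by auto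
  then show "vec.independent (w ` K)"
    unfolding rows using K'(1) vec.independent_mono by (metis image_mono)
  have "inj_on w K'"
  proof (rule inj_onI)
    fix k l assume "k \<in> K'" "l \<in> K'" and eq: "w k = w l"
    then obtain i j where ij: "k = b i" "l = b j" using b by (auto simp: bij_betw_def)
    have "i = j"
    proof (rule ccontr)
      assume "i \<noteq> j"
      then have "det (transpose A) = 0" using eq ij wb by (intro det_identical_rows[of i j]) auto
      then show False using det by simp
    qed
    then show "k = l" using ij by simp
  qed
  then show "inj_on w K" using K'(1) inj_on_subset by blast
qed

text \<open>
  The invariant point set is the orbit of the line spanned by \<open>(1, \<dots>, 1)\<close>.
\<close>

lemma diag_group_admissible:
  fixes e :: "'n::{finite,wellorder} \<Rightarrow> complex"
  assumes p: "prime p" and e: "inj e" "\<And>i. e i ^ p = 1"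
    and n: "CARD('n::{finite,wellorder}) \<ge> 2" "CARD('n) + 2 \<le> p"
  shows "admissible (diag_group e)"
proof -
  define w :: "nat \<Rightarrow> complex^'n::_" where "w = (\<lambda>k. \<chi> i. e i ^ k)"
  define L where "L k = vec.span {w k}" for k
  have p0: "p > 0" using prime_gt_0_nat[OF p] .
  have "w k \<noteq> 0" for k using root_nonzero[OF e(2) p] by (simp add: w_def vec_eq_iff)
  then have pts: "L k \<in> proj_points" for k unfolding L_def by (rule span_singleton_proj_point)
  have wmod: "w (k mod p) = w k" for k
    using root_power_mod[OF e(2)] by (simp add: w_def)
  have LL: "L (k mod p) = L k" for k by (simp add: L_def wmod)
  define T where "T = L ` {..<p}"
  have T_all: "L k \<in> T" for k using LL[of k] p0 by (metis T_def imageI lessThan_iff mod_less_divisor)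
  note gp = fourier_orbit_general_position[OF p e _ w_def]
  have injL: "inj_on L {..<p}"
  proof (rule inj_onI)
    fix k l assume kl: "k \<in> {..<p}" "l \<in> {..<p}" "L k = L l"
    show "k = l"
    proof (rule ccontr)
      assume "k \<noteq> l"
      then have *: "card {k, l} = 2" by simp
      then have ind: "vec.independent (w ` {k, l})" "inj_on w {k, l}"
        using gp[of "{k, l}"] kl n by auto
      then have "w k \<notin> vec.span {w l}"
        using \<open>k \<noteq> l\<close> by (auto simp: vec.dependent_def)
      moreover have "w k \<in> L k" by (simp add: L_def vec.span_base)
      ultimately show False using kl(3) by (simp add: L_def)
    qed
  qed
  have cardT: "card T = p" by (simp add: T_def card_image[OF injL])
  have act: "proj_act (proj_class (diag_mat (\<lambda>i. e i ^ m))) (L k) = L (k + m)" for m k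
  proof -
    have *: "diag_mat (\<lambda>i. e i ^ m) *v w k = w (k + m)"
      by (simp add: vec_eq_iff diag_mat_vec w_def power_add)
    have "proj_act (proj_class (diag_mat (\<lambda>i. e i ^ m))) (L k) = (*v) (diag_mat (\<lambda>i. e i ^ m)) ` L k"
      unfolding L_def by (rule proj_act_rcoset) (rule vec.subspace_span)
    then show ?thesis by (simp add: L_def vec.span_singleton image_image vector_scalar_commute *)
  qed
  have "general_position T"
    unfolding general_position_def
  proof (intro allI impI)
    fix S assume "S \<subseteq> T" "finite S \<and> card S \<le> CARD('n)"
    then have S: "S \<subseteq> T" "finite S" "card S \<le> CARD('n)" by auto
    obtain K where K: "K \<subseteq> {..<p}" "S = L ` K" using S(1) unfolding T_def by (meson subset_imageE)
    have cK: "card S = card K" using K injL card_image inj_on_subset by blast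
    then have g: "vec.independent (w ` K)" "inj_on w K" using gp[of K] K S n by auto
    have "vec.span (\<Union>S) = vec.span (w ` K)"
    proof
      show "vec.span (\<Union>S) \<subseteq> vec.span (w ` K)"
      proof (rule vec.span_minimal)
        show "\<Union>S \<subseteq> vec.span (w ` K)"
        proof
          fix x assume "x \<in> \<Union>S"
          then obtain k where k: "k \<in> K" "x \<in> vec.span {w k}" unfolding K(2) L_def by auto
          have "vec.span {w k} \<subseteq> vec.span (w ` K)" using k(1) by (intro vec.span_mono) auto
          then show "x \<in> vec.span (w ` K)" using k(2) by auto
        qed
      qed simp
      have "w ` K \<subseteq> \<Union>S" unfolding K(2) L_def using vec.span_base by fastforce
      then show "vec.span (w ` K) \<subseteq> vec.span (\<Union>S)" by (rule vec.span_mono)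
    qed
    then show "vec.dim (vec.span (\<Union>S)) = card S"
      using vec.dim_eq_card_independent[OF g(1)] card_image[OF g(2)] cK by simp
  qed
  moreover have "diag_group e \<subseteq> Aut T"
  proof
    fix h assume h: "h \<in> diag_group e"
    then obtain m where m: "h = proj_class (diag_mat (\<lambda>i. e i ^ m))"
      unfolding diag_group_facts(1)[OF p e n(1)] by blast
    have "proj_act h ` T = T"
    proof
      show "proj_act h ` T \<subseteq> T" using T_all by (auto simp: T_def m act)
      show "T \<subseteq> proj_act h ` T"
      proof
        fix M assume "M \<in> T"
        then obtain k where k: "M = L k" by (auto simp: T_def)
        \<comment> \<open>The inverse of \<open>h\<close> is its \<open>(p - 1)\<close>-st power, which shifts the index by \<open>(p - 1) * m\<close>.\<close>
        obtain r where r: "p = Suc r" using p0 by (cases p) auto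
        have "(k + r * m + m) mod p = k mod p"
          unfolding r by (metis add.assoc add.commute mod_mult_self1 mult.commute mult_Suc)
        then have "M = proj_act h (L (k + r * m))" using LL by (metis k m act)
        then show "M \<in> proj_act h ` T" using T_all by blast
      qed
    qed
    then show "h \<in> Aut T"
      using h subgroup.subset[OF diag_group_facts(3)[OF p e n(1)]] by (auto simp: Aut_def)
  qed
  ultimately show ?thesis
    unfolding admissible_def
    using diag_group_facts(2,3)[OF p e n(1)] pts cardT n(2) p0
    by (intro conjI exI[of _ T]) (auto simp: T_def intro: card_ge_0_finite)
qed

lemma diag_group_mem:
  fixes e :: "'n::{finite,wellorder} \<Rightarrow> complex"
  assumes p: "prime p" and e: "inj e" "\<And>i. e i ^ p = 1"
    and n: "CARD('n::{finite,wellorder}) \<ge> 2" "CARD('n) + 2 \<le> p"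
  shows "diag_group e \<in> admissible_cyclic_subgroups p"
  using diag_group_admissible[OF assms] diag_group_facts[OF p e n(1)]
  by (simp add: admissible_cyclic_subgroups_def)

section \<open>Normal form\<close>

abbreviation conj_act :: "(complex^'n^'n) set \<Rightarrow> (complex^'n^'n) set set \<Rightarrow> (complex^'n^'n) set set" where
  "conj_act \<equiv> \<lambda>g H. g <#\<^bsub>PGL\<^esub> H #>\<^bsub>PGL\<^esub> inv\<^bsub>PGL\<^esub> g"

lemma nth_root_exists:
  assumes "n > 0"
  obtains w :: complex where "w ^ n = z"
proof (cases "z = 0")
  case True
  then show ?thesis using that[of 0] assms by (simp add: power_0_left)
next
  case False
  then have "card {w. w ^ n = z} = n" using card_nth_roots assms by blast
  then have "{w. w ^ n = z} \<noteq> {}" using assms by (metis card.empty less_numeral_extra(3))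
  then show ?thesis using that by blast
qed

lemma admissible_lift_diagonalizable:
  fixes A :: "complex^'n^'n"
  assumes p: "prime p" "CARD('n) \<le> p" and A: "invertible A" "mpow A p = mat 1" "proj_class A \<noteq> \<one>\<^bsub>PGL\<^esub>"
    and T: "T \<subseteq> proj_points" "finite T" "card T \<ge> CARD('n) + 1" "general_position T" "proj_class A \<in> Aut T"
  obtains P :: "complex^'n^'n" and e where "invertible P" "inj e" "\<And>i. e i ^ p = 1" "A ** P = P ** diag_mat e"
proof -
  have act: "proj_act (proj_class A) L = (*v) A ` L" if "L \<in> T" for L
    using that T(1) by (intro proj_act_rcoset) (auto simp: proj_points_def)
  have AT: "(*v) A ` L \<in> T" if "L \<in> T" for L
    using T(5) imageI[OF that, of "proj_act (proj_class A)"] act[OF that] by (simp add: Aut_def)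
  have "\<exists>L\<in>T. (*v) A ` L \<noteq> L"
  proof (rule ccontr)
    assume "\<not> (\<exists>L\<in>T. (*v) A ` L \<noteq> L)"
    then have "(*v) A ` L = L" if "L \<in> T" for L using that by blast
    from fixed_points_scalar[OF T(1-4) this] obtain c where c: "A = mat c" .
    then have "c \<noteq> 0" using A(1) by (auto simp: invertible_det_nz det_diag_mat mat_eq_diag_mat)
    then have "proj_class A = proj_class (mat 1)" unfolding proj_class_eq_iff c by (intro exI[of _ c]) simp
    then show False using A(3) by (simp add: one_PGL)
  qed
  then obtain L where "L \<in> T" "(*v) A ` L \<noteq> L" by blast
  from moved_point_cyclic_vector[OF p A(1,2) T(1,4) AT this]
  obtain v where "vec.span ((\<lambda>k. mpow A k *v v) ` {..<p}) = UNIV" by blast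
  from cyclic_vector_diagonalization[OF p(1) A(2) this] that show ?thesis by blast
qed

text \<open>
  A generator of \<open>H\<close> is represented by a matrix whose \<open>p\<close>-th power is scalar.  It is rescaled twice: by a
  \<open>p\<close>-th root of that scalar, which makes the \<open>p\<close>-th power 1, and then by a \<open>p\<close>-th root of unity, which makes
  the product of the eigenvalues 1; the latter works since \<open>CARD('n)\<close> is prime to \<open>p\<close>.
\<close>

lemma admissible_cyclic_normal_form:
  fixes H :: "(complex^'n^'n) set set"
  assumes p: "prime p" "CARD('n) < p" and H: "H \<in> admissible_cyclic_subgroups p"
  obtains P :: "complex^'n^'n" and e where "invertible P" "inj e" "\<And>i. e i ^ p = 1" "(\<Prod>i\<in>UNIV. e i) = 1"
    "H = conj_act (proj_class P) (diag_group e)"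
proof -
  interpret G: group "PGL :: (complex^'n^'n) set monoid" by (rule group_PGL)
  have p0: "p > 0" using prime_gt_0_nat[OF p(1)] .
  have H': "subgroup H PGL" "cyclic_group (subgroup_generated PGL H)" "card H = p"
    using H by (auto simp: admissible_cyclic_subgroups_def admissible_def)
  obtain T where T: "T \<subseteq> proj_points" "finite T" "card T \<ge> CARD('n) + 1" "general_position T" "H \<subseteq> Aut T"
    using H by (auto simp: admissible_cyclic_subgroups_def admissible_def)
  obtain x where x: "x \<in> carrier PGL" "x [^]\<^bsub>PGL\<^esub> p = \<one>\<^bsub>PGL\<^esub>" "x \<noteq> \<one>\<^bsub>PGL\<^esub>" "H = generate PGL {x}"
    by (rule G.cyclic_subgroupE[OF H' p(1)])
  obtain A0 where A0: "invertible A0" "x = proj_class A0" using x(1) by (auto simp: carrier_PGL)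
  have "proj_class (mpow A0 p) = proj_class (mat 1)" using x(2) A0 by (simp add: proj_class_pow one_PGL)
  then obtain c where c: "c \<noteq> 0" "mpow A0 p = mat c" unfolding proj_class_eq_iff by auto
  obtain r where r: "r ^ p = c" by (rule nth_root_exists[OF p0])
  have r0: "r \<noteq> 0" using r c(1) p0 by (auto simp: power_0_left)
  define A where "A = mat (1 / r) ** A0"
  have clsA: "proj_class A = x" unfolding A0(2) proj_class_eq_iff A_def using r0 by (intro exI[of _ "1 / r"]) simp
  have A: "invertible A" using A0(1) r0 by (auto simp: A_def invertible_det_nz det_mul mat_eq_diag_mat det_diag_mat)
  have "mpow A k = mat ((1 / r) ^ k) ** mpow A0 k" for k
  proof (induction k)
    case (Suc k)
    have "mpow A (Suc k) = mat ((1 / r) ^ k) ** (mpow A0 k ** mat (1 / r)) ** A0"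
      unfolding mpow_Suc Suc.IH unfolding A_def by (simp add: matrix_mul_assoc)
    also have "mpow A0 k ** mat (1 / r) = mat (1 / r) ** mpow A0 k" by (rule mat_mult_commute [symmetric])
    finally show ?case by (simp add: mat_mult_mat mpow_Suc mult.commute matrix_mul_assoc)
  qed simp
  then have Ap: "mpow A p = mat 1" using c r r0 by (simp add: mat_mult_mat power_divide)
  have "x \<in> H" using x(1,4) by (simp add: generate.incl)
  then have "proj_class A \<in> Aut T" using T(5) clsA by auto
  then obtain P :: "complex^'n^'n" and f where P: "invertible P" "inj f" "\<And>i. f i ^ p = 1" "A ** P = P ** diag_mat f"
    using admissible_lift_diagonalizable[OF p(1) _ A Ap _ T(1-4)] p(2) clsA x(3) by (metis less_imp_le)
  define \<delta> where "\<delta> = (\<Prod>i\<in>UNIV. f i)"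
  have "\<delta> ^ p = 1" by (simp add: \<delta>_def prod_power_distrib P(3))
  then have "inverse \<delta> \<in> unity_roots p" by (simp add: power_inverse)
  moreover have "\<not> p dvd CARD('n)" using p(2) by (auto dest: dvd_imp_le)
  ultimately have "inverse \<delta> \<in> (\<lambda>z. z ^ CARD('n)) ` unity_roots p"
    by (simp only: power_image_unity_roots[OF p(1)] not_False_eq_True)
  then obtain s where s: "s ^ p = 1" "inverse \<delta> = s ^ CARD('n)" by auto
  have s0: "s \<noteq> 0" using root_nonzero[OF s(1) p(1)] .
  define e where "e i = s * f i" for i
  have inj_e: "inj e" using P(2) s0 by (auto simp: e_def inj_def)
  have ep: "e i ^ p = 1" for i by (simp add: e_def power_mult_distrib s P(3))
  have "\<delta> \<noteq> 0" using root_nonzero[OF \<open>\<delta> ^ p = 1\<close> p(1)] .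
  then have prod: "(\<Prod>i\<in>UNIV. e i) = 1" using s(2) by (simp add: e_def prod.distrib \<delta>_def [symmetric] flip: s(2))
  have dge: "diag_mat e = mat s ** diag_mat f" unfolding mat_eq_diag_mat diag_mat_mult by (simp add: e_def [abs_def])
  have inv_f: "invertible (diag_mat f)" "invertible (diag_mat e)"
    by (rule invertible_diag_mat, rule root_nonzero[OF P(3) p(1)]) (rule invertible_diag_mat, rule root_nonzero[OF ep p(1)])
  have "proj_class (diag_mat e) = proj_class (diag_mat f)" unfolding proj_class_eq_iff dge using s0 by blast
  then have "proj_class P \<otimes>\<^bsub>PGL\<^esub> proj_class (diag_mat e) \<otimes>\<^bsub>PGL\<^esub> inv\<^bsub>PGL\<^esub> proj_class P = x"
    using proj_class_conj[OF P(1) A inv_f(1) P(4)] clsA by simp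
  moreover have "proj_class P \<in> carrier PGL" "proj_class (diag_mat e) \<in> carrier PGL" using P(1) inv_f by (auto simp: carrier_PGL)
  ultimately have "conj_act (proj_class P) (diag_group e) = H"
    unfolding diag_group_def x(4) by (simp add: G.conj_generate)
  then show ?thesis using that P(1) inj_e ep prod by blast
qed

text \<open>
  The columns of \<open>P\<close> are eigenvectors, and none of them is zero.
\<close>

lemma intertwined_diagonals:
  fixes P :: "complex^'n^'n"
  assumes P: "invertible P" and eq: "diag_mat f ** P = P ** diag_mat e"
  shows "range e \<subseteq> range f"
proof
  fix z assume "z \<in> range e"
  then obtain j where j: "z = e j" by auto
  have "\<exists>i. P $ i $ j \<noteq> 0"
  proof (rule ccontr)
    assume "\<not> (\<exists>i. P $ i $ j \<noteq> 0)"
    then have "column j P = 0" by (simp add: column_def vec_eq_iff)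
    then have "det P = 0" by (rule det_zero_column)
    then show False using P by (simp add: invertible_det_nz)
  qed
  then obtain i where i: "P $ i $ j \<noteq> 0" by auto
  have "(diag_mat f ** P) $ i $ j = (P ** diag_mat e) $ i $ j" by (simp add: eq)
  then have "f i = e j" using i by (simp add: diag_mat_mult_left mult_diag_mat)
  then show "z \<in> range f" using j by (metis rangeI)
qed

text \<open>
  A conjugation maps the generator of the first group to the class of \<open>c\<close> times the \<open>k\<close>-th power of
  the generator of the second.  The \<open>p\<close>-th power gives \<open>c\<^sup>p = 1\<close>, the determinant gives \<open>c ^ CARD('n) = 1\<close>, so
  \<open>c = 1\<close>, and the eigenvalues of the one matrix are the \<open>k\<close>-th powers of those of the other.  Conversely, equal
  sets of eigenvalues are matched by a permutation matrix.
\<close>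

lemma conj_diag_group_iff:
  fixes e e' :: "'n::finite \<Rightarrow> complex"
  assumes p: "prime p" "CARD('n) < p" "CARD('n) \<ge> 2"
    and e: "inj e" "\<And>i. e i ^ p = 1" "(\<Prod>i\<in>UNIV. e i) = 1"
    and e': "inj e'" "\<And>i. e' i ^ p = 1" "(\<Prod>i\<in>UNIV. e' i) = 1"
  shows "(\<exists>g\<in>carrier PGL. conj_act g (diag_group e) = diag_group e')
    \<longleftrightarrow> (\<exists>k\<in>totatives p. (\<lambda>z. z ^ k) ` range e' = range e)" (is "?L \<longleftrightarrow> ?R")
proof -
  interpret G: group "PGL :: (complex^'n^'n) set monoid" by (rule group_PGL)
  have p0: "p > 0" using prime_gt_0_nat[OF p(1)] .
  note x = proj_class_diag_mat_props[OF p(1) e(1,2) p(3)] and x' = proj_class_diag_mat_props[OF p(1) e'(1,2) p(3)]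
  have ?R if ?L
  proof -
    from that obtain P where P: "invertible P" "conj_act (proj_class P) (diag_group e) = diag_group e'"
      by (auto simp: carrier_PGL)
    have clsP: "proj_class P \<in> carrier PGL" using P(1) by (auto simp: carrier_PGL)
    have "proj_class P \<otimes>\<^bsub>PGL\<^esub> proj_class (diag_mat e) \<otimes>\<^bsub>PGL\<^esub> inv\<^bsub>PGL\<^esub> proj_class P \<in> diag_group e'"
      unfolding P(2)[symmetric] unfolding diag_group_def G.conj_generate[OF clsP x(2)]
      by (rule generate.incl) simp
    then obtain k where k: "proj_class P \<otimes>\<^bsub>PGL\<^esub> proj_class (diag_mat e) \<otimes>\<^bsub>PGL\<^esub> inv\<^bsub>PGL\<^esub> proj_class P = proj_class (diag_mat (\<lambda>i. e' i ^ k))"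
      using diag_group_facts(1)[OF p(1) e'(1,2) p(3)] by auto
    have inv_k: "invertible (diag_mat (\<lambda>i. e' i ^ k))"
      using root_nonzero[OF e'(2) p(1)] by (intro invertible_diag_mat) simp
    then have "proj_class (diag_mat (\<lambda>i. e' i ^ k)) \<in> carrier PGL" by (auto simp: carrier_PGL)
    then have "proj_class P \<otimes>\<^bsub>PGL\<^esub> proj_class (diag_mat e) = proj_class (diag_mat (\<lambda>i. e' i ^ k)) \<otimes>\<^bsub>PGL\<^esub> proj_class P"
      using k clsP x(2) by (metis G.inv_closed G.inv_solve_right' G.m_closed)
    then have "proj_class (P ** diag_mat e) = proj_class (diag_mat (\<lambda>i. e' i ^ k) ** P)"
      using P(1) x(1) inv_k by (simp add: proj_class_mult)
    then obtain c where c: "c \<noteq> 0" "P ** diag_mat e = mat c ** (diag_mat (\<lambda>i. e' i ^ k) ** P)"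
      unfolding proj_class_eq_iff by blast
    define f where "f i = c * e' i ^ k" for i
    have dgf: "diag_mat f ** P = P ** diag_mat e"
      using c(2) by (simp add: f_def [abs_def] matrix_mul_assoc mat_eq_diag_mat diag_mat_mult)
    have detP: "det P \<noteq> 0" using P(1) by (simp add: invertible_det_nz)
    have "det (diag_mat f) * det P = det P * det (diag_mat e)" using dgf by (metis det_mul)
    then have "c ^ CARD('n) = 1"
      using detP e(3) e'(3) by (simp add: det_diag_mat f_def prod.distrib flip: prod_power_distrib)
    moreover have "c ^ p = 1"
    proof -
      have ek: "(e' i ^ k) ^ p = 1" for i by (metis e'(2) mult.commute power_mult power_one)
      have "mpow (diag_mat f) p ** P = P ** mpow (diag_mat e) p" by (rule mpow_intertwine[OF dgf])
      also have "mpow (diag_mat e) p = mat 1" by (simp add: mpow_diag_mat e(2) mat_eq_diag_mat)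
      also have "mpow (diag_mat f) p = mat (c ^ p)"
        by (simp add: mpow_diag_mat mat_eq_diag_mat f_def power_mult_distrib ek)
      finally have "mat (c ^ p) ** P = P" by simp
      then have "(mat (c ^ p) ** P) $ i $ j = P $ i $ j" for i j by simp
      then have "c ^ p * P $ i $ j = P $ i $ j" for i j by (simp add: mat_eq_diag_mat diag_mat_mult_left)
      moreover have "\<exists>i j. P $ i $ j \<noteq> 0"
      proof (rule ccontr)
        assume "\<not> (\<exists>i j. P $ i $ j \<noteq> 0)"
        then have "P = mat 0" by (simp add: vec_eq_iff mat_def)
        then have "det P = 0" by (simp only: det_0)
        then show False using detP by simp
      qed
      ultimately show ?thesis by (metis mult_cancel_right1 mult.commute)
    qed
    moreover have "\<not> p dvd CARD('n)" using p(2) by (auto dest: dvd_imp_le)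
    ultimately have "c = 1" using root_power_eq_1_iff[OF p(1), of c "CARD('n)"] by auto
    then have f: "f = (\<lambda>i. e' i ^ k)" by (simp add: f_def [abs_def])
    have sub: "range e \<subseteq> (\<lambda>z. z ^ k) ` range e'"
      using intertwined_diagonals[OF P(1) dgf] by (auto simp: f)
    have "card ((\<lambda>z. z ^ k) ` range e') \<le> card (range e')" by (rule card_image_le) simp
    then have eq: "range e = (\<lambda>z. z ^ k) ` range e'"
      using sub by (intro card_seteq) (auto simp: card_image e(1) e'(1))
    have "\<not> p dvd k"
    proof
      assume "p dvd k"
      then have "e' i ^ k = 1" for i using e'(2)[of i] by (auto simp: power_mult elim!: dvdE)
      then have "range e \<subseteq> {1}" using sub by auto
      then have "card (range e) \<le> 1" using card_mono[of "{1}" "range e"] by simp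
      then show False using p(3) by (simp add: card_image e(1))
    qed
    then have "k mod p \<in> totatives p"
      using p0 by (simp add: prime_totatives_iff p(1) mod_greater_zero_iff_not_dvd)
    moreover have "(\<lambda>z. z ^ (k mod p)) ` range e' = range e"
      unfolding eq image_image by (simp add: root_power_mod e'(2))
    ultimately show ?R by blast
  qed
  moreover have ?L if ?R
  proof -
    from that obtain k where k: "k \<in> totatives p" "(\<lambda>z. z ^ k) ` range e' = range e" by blast
    have "\<exists>j. e i = e' j ^ k" for i
    proof -
      have "e i \<in> (\<lambda>z. z ^ k) ` range e'" unfolding k(2) by simp
      then show ?thesis by auto
    qed
    then obtain \<pi> where \<pi>: "e i = e' (\<pi> i) ^ k" for i by metis
    have "inj \<pi>" by (rule injI) (metis \<pi> e(1) injD)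
    then have "surj \<pi>" by (simp add: finite_UNIV_inj_surj)
    \<comment> \<open>The permutation matrix that matches the two enumerations.\<close>
    define P where "P = (\<chi> i j. if i = \<pi> j then (1 :: complex) else 0)"
    have PP: "transpose P ** P = mat 1"
    proof -
      have "(\<Sum>k\<in>UNIV. (if k = \<pi> i then 1 else 0) * (if k = \<pi> j then 1 else 0 :: complex)) = (if i = j then 1 else 0)" for i j
      proof -
        have "(\<Sum>k\<in>UNIV. (if k = \<pi> i then 1 else 0) * (if k = \<pi> j then 1 else 0 :: complex))
            = (\<Sum>k\<in>UNIV. if k = \<pi> i then (if i = j then 1 else 0) else 0)"
          by (rule sum.cong) (use \<open>inj \<pi>\<close> in \<open>auto dest: injD\<close>)
        then show ?thesis by simp
      qed
      then show ?thesis by (simp add: P_def transpose_def matrix_matrix_mult_def mat_def vec_eq_iff)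
    qed
    then have invP: "invertible P" by (auto simp: invertible_left_inverse)
    have "diag_mat (\<lambda>i. e' i ^ k) ** P = P ** diag_mat e"
      by (simp add: vec_eq_iff diag_mat_mult_left mult_diag_mat) (simp add: P_def \<pi>)
    moreover have "invertible (diag_mat (\<lambda>i. e' i ^ k))"
      using root_nonzero[OF e'(2) p(1)] by (intro invertible_diag_mat) simp
    ultimately have conj: "proj_class P \<otimes>\<^bsub>PGL\<^esub> proj_class (diag_mat e) \<otimes>\<^bsub>PGL\<^esub> inv\<^bsub>PGL\<^esub> proj_class P = proj_class (diag_mat (\<lambda>i. e' i ^ k))"
      using proj_class_conj[OF invP _ x(1)] by blast
    have clsP: "proj_class P \<in> carrier PGL" using invP by (auto simp: carrier_PGL)
    have "inj (\<lambda>i. e' i ^ k)"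
    proof -
      have "\<not> p dvd k" using k(1) p(1) by (auto simp: prime_totatives_iff dest: dvd_imp_le)
      then show ?thesis
        using inj_on_power_unity_roots[OF p(1)] e'(1,2) by (auto simp: inj_on_def)
    qed
    moreover have "(e' i ^ k) ^ p = 1" for i by (metis e'(2) mult.commute power_mult power_one)
    ultimately have card_k: "card (diag_group (\<lambda>i. e' i ^ k)) = p"
      using diag_group_facts(2)[OF p(1) _ _ p(3)] by blast
    have "diag_group (\<lambda>i. e' i ^ k) \<subseteq> diag_group e'"
    proof -
      have "proj_class (diag_mat (\<lambda>i. e' i ^ k)) \<in> diag_group e'"
        using diag_group_facts(1)[OF p(1) e'(1,2) p(3)] by blast
      then show ?thesis
        using G.generate_subgroup_incl[OF _ diag_group_facts(3)[OF p(1) e'(1,2) p(3)]]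
        by (simp add: diag_group_def)
    qed
    moreover have "card (diag_group e') = p" by (rule diag_group_facts(2)[OF p(1) e'(1,2) p(3)])
    ultimately have "diag_group (\<lambda>i. e' i ^ k) = diag_group e'"
      using card_k p0 by (intro card_subset_eq) (auto intro: card_ge_0_finite)
    then have "conj_act (proj_class P) (diag_group e) = diag_group e'"
      unfolding diag_group_def G.conj_generate[OF clsP x(2)] conj by simp
    then show ?L using clsP by blast
  qed
  ultimately show ?thesis by blast
qed

section \<open>Counting conjugacy classes\<close>

lemma (in group_action) orbit_eq_iff:
  assumes "x \<in> E" "y \<in> E"
  shows "orbit G \<phi> x = orbit G \<phi> y \<longleftrightarrow> (\<exists>g\<in>carrier G. \<phi> g x = y)"
proof
  assume "orbit G \<phi> x = orbit G \<phi> y"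
  then have "y \<in> orbit G \<phi> x" using orbit_refl[OF assms(2)] by simp
  then show "\<exists>g\<in>carrier G. \<phi> g x = y" by (auto simp: orbit_def)
next
  assume "\<exists>g\<in>carrier G. \<phi> g x = y"
  then have "y \<in> orbit G \<phi> x" by (auto simp: orbit_def)
  then have "orbit G \<phi> x \<inter> orbit G \<phi> y \<noteq> {}" using orbit_refl[OF assms(2)] by auto
  then show "orbit G \<phi> x = orbit G \<phi> y"
    using disjoint_union[of "orbit G \<phi> x" "orbit G \<phi> y"] assms by (auto simp: orbits_def)
qed

text \<open>
  Conjugation acts on the subsets of the carrier as a group action once it is restricted to them,
  and the restriction does not affect the orbits.
\<close>

lemma conj_orbit_eq_iff:
  fixes H H' :: "(complex^'n^'n) set set"
  assumes "H \<subseteq> carrier PGL" "H' \<subseteq> carrier PGL"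
  shows "orbit PGL conj_act H = orbit PGL conj_act H' \<longleftrightarrow> (\<exists>g\<in>carrier PGL. conj_act g H = H')"
proof -
  let ?E = "{H. H \<subseteq> carrier (PGL :: (complex^'n^'n) set monoid)}"
  interpret group_action PGL ?E "\<lambda>g. \<lambda>H\<in>?E. conj_act g H"
    by (rule group.action_by_conjugation_on_power_set[OF group_PGL])
  have "orbit PGL conj_act K = orbit PGL (\<lambda>g. \<lambda>H\<in>?E. conj_act g H) K" if "K \<in> ?E" for K
    using that by (simp add: orbit_def)
  then show ?thesis using orbit_eq_iff[of H H'] assms by simp
qed

lemma card_image_eq_if_same_fibres:
  assumes "\<And>x y. x \<in> X \<Longrightarrow> y \<in> X \<Longrightarrow> f x = f y \<longleftrightarrow> g x = g y"
  shows "card (f ` X) = card (g ` X)"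
proof -
  have "bij_betw (\<lambda>y. g (inv_into X f y)) (f ` X) (g ` X)"
  proof (rule bij_betwI[where g = "\<lambda>z. f (inv_into X g z)"])
    show "(\<lambda>y. g (inv_into X f y)) \<in> f ` X \<rightarrow> g ` X" by (auto intro: inv_into_into)
    show "(\<lambda>z. f (inv_into X g z)) \<in> g ` X \<rightarrow> f ` X" by (auto intro: inv_into_into)
    fix y assume "y \<in> f ` X"
    then have y: "inv_into X f y \<in> X" "f (inv_into X f y) = y" by (auto intro: inv_into_into f_inv_into_f)
    then have "inv_into X g (g (inv_into X f y)) \<in> X" "g (inv_into X g (g (inv_into X f y))) = g (inv_into X f y)"
      by (auto intro: inv_into_into f_inv_into_f)
    then show "f (inv_into X g (g (inv_into X f y))) = y" using assms y by metis
  next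
    fix z assume "z \<in> g ` X"
    then have z: "inv_into X g z \<in> X" "g (inv_into X g z) = z" by (auto intro: inv_into_into f_inv_into_f)
    then have "inv_into X f (f (inv_into X g z)) \<in> X" "f (inv_into X f (f (inv_into X g z))) = f (inv_into X g z)"
      by (auto intro: inv_into_into f_inv_into_f)
    then show "g (inv_into X f (f (inv_into X g z))) = z" using assms z by metis
  qed
  then show ?thesis by (rule bij_betw_same_card)
qed

text \<open>
  Each set \<open>E\<close> in \<open>root_sets p CARD('n)\<close> is enumerated as a diagonal.  By the normal form, every class
  contains the group of such a diagonal, and two of them lie in the same class if and only if the sets lie in the same
  orbit of the power maps.
\<close>

lemma card_conjugacy_classes:
  assumes p: "prime p" "CARD('n::{finite,wellorder}) + 2 \<le> p" "CARD('n) \<ge> 2"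
  shows "card (conjugacy_classes (admissible_cyclic_subgroups p :: (complex^'n::_^'n::_) set set set))
    = card (orbits (power_units p) (root_sets p CARD('n)) (power_action p CARD('n)))"
proof -
  let ?X = "root_sets p CARD('n)"
  let ?C = "admissible_cyclic_subgroups p :: (complex^'n::_^'n::_) set set set"
  have lt: "CARD('n) < p" using p(2) by simp
  have "\<exists>e. bij_betw e (UNIV :: 'n set) E" if "E \<in> ?X" for E
    using that finite_same_card_bij[of "UNIV :: 'n set" E] finite_unity_roots[OF p(1)]
    by (auto simp: root_sets_def intro: finite_subset)
  then obtain en where en: "\<And>E. E \<in> ?X \<Longrightarrow> bij_betw (en E) (UNIV :: 'n set) E" by metis
  have en': "inj (en E)" "range (en E) = E" "en E i ^ p = 1" "(\<Prod>i\<in>UNIV. en E i) = 1" if "E \<in> ?X" for E i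
  proof -
    show 1: "inj (en E)" "range (en E) = E" using en[OF that] by (auto simp: bij_betw_def)
    have "en E i \<in> E" using 1 by auto
    then show "en E i ^ p = 1" using that by (auto simp: root_sets_def)
    show "(\<Prod>i\<in>UNIV. en E i) = 1"
      using that prod.reindex_bij_betw[OF en[OF that], of "\<lambda>z. z"] by (simp add: root_sets_def)
  qed
  define F where "F E = orbit PGL conj_act (diag_group (en E))" for E
  have sub: "diag_group (en E) \<subseteq> carrier PGL" if "E \<in> ?X" for E
    using subgroup.subset[OF diag_group_facts(3)[OF p(1) en'(1)[OF that] en'(3)[OF that] p(3)]] .
  have F_iff: "F E = F E' \<longleftrightarrow> orbit (power_units p) (power_action p CARD('n)) E' = orbit (power_units p) (power_action p CARD('n)) E"
    if E: "E \<in> ?X" "E' \<in> ?X" for E E'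
  proof -
    have "F E = F E' \<longleftrightarrow> (\<exists>k\<in>totatives p. (\<lambda>z. z ^ k) ` E' = E)"
      unfolding F_def conj_orbit_eq_iff[OF sub[OF E(1)] sub[OF E(2)]]
      using conj_diag_group_iff[OF p(1) lt p(3) en'(1)[OF E(1)] en'(3)[OF E(1)] en'(4)[OF E(1)] en'(1)[OF E(2)] en'(3)[OF E(2)] en'(4)[OF E(2)]]
        en'(2)[OF E(1)] en'(2)[OF E(2)] by simp
    also have "\<dots> \<longleftrightarrow> (\<exists>k\<in>carrier (power_units p). power_action p CARD('n) k E' = E)"
      using E by (simp add: power_units_def power_action_def)
    finally show ?thesis
      using group_action.orbit_eq_iff[OF power_action_group_action[OF p(1)] E(2,1)] by simp
  qed
  have "conjugacy_classes ?C = F ` ?X"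
  proof
    show "F ` ?X \<subseteq> conjugacy_classes ?C"
      using diag_group_mem[OF p(1) en'(1,3) p(3,2)] by (auto simp: conjugacy_classes_def orbits_def F_def)
    show "conjugacy_classes ?C \<subseteq> F ` ?X"
    proof
      fix c assume "c \<in> conjugacy_classes ?C"
      then obtain H where H: "H \<in> ?C" "c = orbit PGL conj_act H" by (auto simp: conjugacy_classes_def orbits_def)
      obtain P :: "complex^'n::_^'n::_" and e where P: "invertible P" "inj e" "\<And>i. e i ^ p = 1" "(\<Prod>i\<in>UNIV. e i) = 1"
        "H = conj_act (proj_class P) (diag_group e)"
        using admissible_cyclic_normal_form[OF p(1) lt H(1)] by blast
      have sub_e: "diag_group e \<subseteq> carrier PGL"
        using subgroup.subset[OF diag_group_facts(3)[OF p(1) P(2,3) p(3)]] .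
      have sub_H: "H \<subseteq> carrier PGL"
        using H(1) subgroup.subset by (auto simp: admissible_cyclic_subgroups_def admissible_def)
      have "proj_class P \<in> carrier PGL" using P(1) by (auto simp: carrier_PGL)
      then have c: "c = orbit PGL conj_act (diag_group e)"
        using conj_orbit_eq_iff[OF sub_e sub_H] P(5) H(2) by auto
      define E where "E = range e"
      have E: "E \<in> ?X"
        using P(3,4) by (auto simp: root_sets_def E_def card_image[OF P(2)] prod.reindex[OF P(2)])
      have "1 \<in> totatives p" using p by (simp add: prime_totatives_iff)
      moreover have "(\<lambda>z. z ^ 1) ` range (en E) = range e" using en'(2)[OF E] by (simp add: E_def)
      ultimately have "\<exists>g\<in>carrier PGL. conj_act g (diag_group e) = diag_group (en E)"
        using conj_diag_group_iff[OF p(1) lt p(3) P(2-4) en'(1)[OF E] en'(3)[OF E] en'(4)[OF E]] by blast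
      then have "c = F E" unfolding c F_def using conj_orbit_eq_iff[OF sub_e sub[OF E]] by blast
      then show "c \<in> F ` ?X" using E by blast
    qed
  qed
  moreover have "orbits (power_units p) ?X (power_action p CARD('n)) = orbit (power_units p) (power_action p CARD('n)) ` ?X"
    by (auto simp: orbits_def)
  moreover have "card (F ` ?X) = card (orbit (power_units p) (power_action p CARD('n)) ` ?X)"
    by (rule card_image_eq_if_same_fibres) (use F_iff in \<open>metis\<close>)
  ultimately show ?thesis by simp
qed

theorem theorem3:
  fixes p :: nat and \<Phi> \<beta> N :: real
  assumes "prime p" and "p > 5"
    and "\<Phi> = (real p - 2) * (real p - 3) * (real p - 4)"
    and "\<beta> = 15 * (real p - 3)"
    and "N = real (card (conjugacy_classes
               (admissible_cyclic_subgroups p :: (complex^5^5) set set set)))"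
  shows "(\<not> [p = 1] (mod 5) \<and> \<not> [p = 1] (mod 4) \<longrightarrow> N = \<beta> / 60 + (\<Phi> - \<beta>) / 120) \<and>
         (\<not> [p = 1] (mod 5) \<and> [p = 1] (mod 4) \<longrightarrow> N = 1 + (\<beta> - 30) / 60 + (\<Phi> - \<beta>) / 120) \<and>
         ([p = 1] (mod 5) \<and> \<not> [p = 1] (mod 4) \<longrightarrow> N = 1 + \<beta> / 60 + (\<Phi> - \<beta> - 24) / 120) \<and>
         ([p = 1] (mod 5) \<and> [p = 1] (mod 4) \<longrightarrow> N = 2 + (\<beta> - 30) / 60 + (\<Phi> - \<beta> - 24) / 120)"
proof -
  have "p \<noteq> 6" using assms(1) by (auto simp: prime_nat_iff dest!: spec[of _ 2])
  then have p7: "p \<ge> 7" using assms(2) by linarith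
  have dvd_iff: "d dvd p - 1 \<longleftrightarrow> [p = 1] (mod d)" for d
    using mod_eq_dvd_iff_nat[of 1 p d] p7 by (simp add: cong_def)
  have div_eq: "(if d dvd p - 1 then c * real ((p - 1) div d) else 0)
      = (real p - 1) * (if [p = 1] (mod d) then c / real d else 0)" for d c
    using p7 by (simp add: dvd_iff real_of_nat_div of_nat_diff del: One_nat_def flip: dvd_iff)
  define X where "X = card (root_sets p 5)"
  have N: "N = real (card (orbits (power_units p) (root_sets p 5) (power_action p 5)))"
    unfolding assms(5) using card_conjugacy_classes[where 'n=5, OF assms(1)] p7 by simp
  have "N * (real p - 1) = real (card (orbits (power_units p) (root_sets p 5) (power_action p 5)) * (p - 1))"
    using p7 by (simp add: N of_nat_diff)
  also have "\<dots> = real X + real (((p - 1) div 2) choose 2)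
     + (if 4 dvd p - 1 then 2 * real ((p - 1) div 4) else 0) + (if 5 dvd p - 1 then 4 * real ((p - 1) div 5) else 0)"
    unfolding card_power_orbits[OF assms(1,2)] X_def by simp
  also have "real X = (real p - 1) * \<Phi> / 120"
  proof -
    have "\<not> p dvd 5" using assms(2) by (auto dest: dvd_imp_le)
    then have "real p * real X = real (p choose 5)"
      using card_root_sets[OF assms(1), of 5] by (simp add: X_def flip: of_nat_mult)
    moreover have "120 * real (p choose 5) = real p * (real p - 1) * (real p - 2) * (real p - 3) * (real p - 4)"
      using gbinomial_mult_fact[of 5 "real p"]
      by (simp add: binomial_gbinomial fact_numeral atLeast0_lessThan_Suc numeral_eq_Suc mult_ac)
    ultimately have "120 * (real p * real X) = real p * (real p - 1) * (real p - 2) * (real p - 3) * (real p - 4)"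
      by simp
    then have "real p * (120 * real X) = real p * ((real p - 1) * \<Phi>)"
      by (simp only: assms(3) mult_ac)
    then show ?thesis using p7 by simp
  qed
  also have "real (((p - 1) div 2) choose 2) = (real p - 1) * (real p - 3) / 8"
  proof -
    have "odd p" using assms(1,2) prime_odd_nat by auto
    then obtain m where m: "p = 2 * m + 1" by (auto elim: oddE)
    have "2 * real (m choose 2) = real m * (real m - 1)"
      using gbinomial_mult_fact[of 2 "real m"]
      by (simp add: binomial_gbinomial fact_numeral atLeast0_lessThan_Suc numeral_eq_Suc mult_ac)
    then show ?thesis by (simp add: m field_simps)
  qed
  also have "(if 4 dvd p - 1 then 2 * real ((p - 1) div 4) else 0) = (real p - 1) * (if [p = 1] (mod 4) then 1 / 2 else 0)"
    using div_eq[of 4 2] by simp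
  also have "(if 5 dvd p - 1 then 4 * real ((p - 1) div 5) else 0) = (real p - 1) * (if [p = 1] (mod 5) then 4 / 5 else 0)"
    using div_eq[of 5 4] by simp
  finally have "(real p - 1) * N = (real p - 1) * (\<Phi> / 120 + (real p - 3) / 8
      + (if [p = 1] (mod 4) then 1 / 2 else 0) + (if [p = 1] (mod 5) then 4 / 5 else 0))"
    by (simp add: algebra_simps)
  then have "N = \<Phi> / 120 + (real p - 3) / 8
      + (if [p = 1] (mod 4) then 1 / 2 else 0) + (if [p = 1] (mod 5) then 4 / 5 else 0)"
    using p7 by simp
  then show ?thesis by (auto simp: assms(4) field_simps)
qed

end
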